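(* Let $\Omega\subset\mathbb{R}^n$ be a bounded measurable set with $|\Omega|=1$ and let $a,d,\kappa_0>0$. Assume that $u_0\in C(\overline\Omega)$ is nonnegative and $\xi_0>0$. Then the initial value problem $$u_t=\Big(\frac{au\xi}{1+u\xi}-d\Big)u\quad(x\in\Omega,\ t>0),\qquad \xi_t=-\xi-\xi\int_\Omega u^2\,dx+\kappa_0\quad(t>0),$$ $$u(x,0)=u_0(x),\qquad \xi(0)=\xi_0$$ has a unique, global-in-time, nonnegative solution $u\in C([0,\infty),C(\overline\Omega))$, $\xi\in C^1([0,\infty))$. This solution satisfies the equation for $u$ in the classical sense, because $u(x,\cdot)\in C^1([0,\infty))$ for every $x\in\Omega$. The following pointwise estimates hold: $$0\le u(x,t)\le e^{(a-d)t}u_0(x)\qquad\text{and}\qquad 0<\xi(t)\le\max\{\xi_0,\kappa_0\}$$ for all $x\in\Omega$ and $t\ge0$. Moreover, $$\sup_{t>0}\int_\Omega u(x,t)\,dx<\infty .$$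
   Context: The unknowns are $u=u(x,t)$ and $\xi=\xi(t)$; $|\Omega|$ denotes the Lebesgue measure of $\Omega$. *)

theory Defs
  imports "HOL-Analysis.Analysis"
begin

text \<open>
  Throughout, a function \<open>u x t\<close> matters only for \<open>x \<in> closure \<Omega>\<close> and \<open>t \<ge> 0\<close>, and a function
  \<open>\<xi> t\<close> only for \<open>t \<ge> 0\<close>; uniqueness of solutions is therefore equality on these sets.
\<close>

text \<open>
  The class \<open>C([0,\<infinity>), C(closure \<Omega>))\<close>, where \<open>C(closure \<Omega>)\<close> carries the supremum norm: convergence
  in that norm is uniform convergence on \<open>closure \<Omega>\<close>.
\<close>

definition C_time_space :: "(real ^ 'n) set \<Rightarrow> (real ^ 'n \<Rightarrow> real \<Rightarrow> real) \<Rightarrow> bool" where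
  "C_time_space \<Omega> u \<longleftrightarrow>
     (\<forall>t\<ge>0. continuous_on (closure \<Omega>) (\<lambda>x. u x t)) \<and>
     (\<forall>t\<ge>0. uniform_limit (closure \<Omega>) (\<lambda>s x. u x s) (\<lambda>x. u x t) (at t within {0..}))"

text \<open>
  The class \<open>C\<^sup>1([0,\<infinity>))\<close>, with a one-sided derivative at \<open>0\<close>.  The library's
  \<open>C1_differentiable_on\<close> asks for a two-sided derivative at \<open>0\<close>, so it does not fit here.
\<close>

definition C1_halfline :: "(real \<Rightarrow> real) \<Rightarrow> bool" where
  "C1_halfline f \<longleftrightarrow>
     (\<exists>f'. continuous_on {0..} f' \<and>
           (\<forall>t\<ge>0. (f has_real_derivative f' t) (at t within {0..})))"

text \<open>
  Global nonnegative solutions.  For \<open>u\<close> only differentiability in time at \<open>x \<in> \<Omega>\<close>, \<open>t > 0\<close> is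
  required, as needed for the equation to make sense; \<open>C\<^sup>1\<close> regularity of \<open>u x\<close> up to \<open>t = 0\<close> is
  not part of the notion of solution.
\<close>

definition nonneg_global_solution ::
    "(real ^ 'n) set \<Rightarrow> real \<Rightarrow> real \<Rightarrow> real \<Rightarrow> (real ^ 'n \<Rightarrow> real) \<Rightarrow> real \<Rightarrow>
     (real ^ 'n \<Rightarrow> real \<Rightarrow> real) \<Rightarrow> (real \<Rightarrow> real) \<Rightarrow> bool" where
  "nonneg_global_solution \<Omega> a d \<kappa>\<^sub>0 u\<^sub>0 \<xi>\<^sub>0 u \<xi> \<longleftrightarrow>
     C_time_space \<Omega> u \<and> C1_halfline \<xi> \<and>
     (\<forall>x\<in>closure \<Omega>. \<forall>t\<ge>0. 0 \<le> u x t) \<and> (\<forall>t\<ge>0. 0 \<le> \<xi> t) \<and>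
     (\<forall>x\<in>\<Omega>. \<forall>t>0.
        (u x has_real_derivative (a * u x t * \<xi> t / (1 + u x t * \<xi> t) - d) * u x t) (at t)) \<and>
     (\<forall>t>0. (\<xi> has_real_derivative
        - \<xi> t - \<xi> t * (LINT x:\<Omega>|lebesgue. (u x t)\<^sup>2) + \<kappa>\<^sub>0) (at t)) \<and>
     (\<forall>x\<in>closure \<Omega>. u x 0 = u\<^sub>0 x) \<and> \<xi> 0 = \<xi>\<^sub>0"

end

theory Submission
  imports Defs
begin

text \<open>
  Extend \<open>u\<^sub>0\<close> to a nonnegative bounded continuous function on \<open>\<real>\<^sup>n\<close> and regard the system as an ordinary
  differential equation in the Banach space \<open>C\<^sub>b(\<real>\<^sup>n) \<times> \<real>\<close>. Cutting \<open>u\<close> off at the time-dependent level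
  \<open>M exp (a t)\<close>, \<open>M = sup u\<^sub>0\<close>, and \<open>\<xi>\<close> at \<open>max \<xi>\<^sub>0 \<kappa>\<^sub>0\<close> makes the field globally Lipschitz with a constant
  depending continuously on \<open>t\<close>, so the cut-off equation has a global solution. Integrating factors show
  that this solution never reaches the cut-off, hence solves the original system. The same a priori bounds
  hold for every nonnegative solution, which gives uniqueness by a Gronwall argument. For the bound on the
  total mass, \<open>y = \<integral> u + a \<xi>\<close> satisfies \<open>y' \<le> a \<kappa>\<^sub>0 - min d 1 * y\<close>.
\<close>

subsection \<open>Differential equations and inequalities on the half-line\<close>

text \<open>Near \<open>t\<close> the half-line and \<open>{0..t+1}\<close> coincide, so the
  fundamental theorem on compact intervals carries over, one-sidedly at \<open>0\<close>.\<close>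

lemma integral_has_vector_derivative_halfline:
  fixes f :: "real \<Rightarrow> 'a::banach"
  assumes "continuous_on {0..} f" and "0 \<le> t"
  shows "((\<lambda>s. integral {0..s} f) has_vector_derivative f t) (at t within {0..})"
proof -
  have "((\<lambda>s. integral {0..s} f) has_vector_derivative f t) (at t within {0..t+1})"
    using assms by (intro integral_has_vector_derivative) (auto elim: continuous_on_subset)
  moreover have "at t within {0..t+1} = at t within {0..}"
    by (rule at_within_nhd[of t "{..<t+1}"]) (auto simp: \<open>0 \<le> t\<close>)
  ultimately show ?thesis by simp
qed

text \<open>
  With \<open>P\<close> a primitive of \<open>l = \<bar>L\<bar> + norm (F \<cdot> 0)\<close>, the Picard operator is a contraction with factor
  \<open>1/2\<close> in the supremum norm weighted by \<open>exp (- 2 P t)\<close>, so no continuation argument is needed.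
\<close>

theorem picard_halfline:
  fixes F :: "real \<Rightarrow> 'a::banach \<Rightarrow> 'a" and L :: "real \<Rightarrow> real"
  assumes cont: "\<And>z. continuous_on {0..} z \<Longrightarrow> continuous_on {0..} (\<lambda>t. F t (z t))"
    and contL: "continuous_on {0..} L"
    and lip: "\<And>t y z. 0 \<le> t \<Longrightarrow> norm (F t y - F t z) \<le> L t * norm (y - z)"
  obtains z where "z 0 = z\<^sub>0"
    and "\<And>t. 0 \<le> t \<Longrightarrow> (z has_vector_derivative F t (z t)) (at t within {0..})"
proof -
  \<comment> \<open>Adding \<open>norm (F t 0)\<close> lets one weight serve twice: for the
    contraction estimate and for the boundedness of the image of a bounded function.\<close>
  define l where "l = (\<lambda>t. \<bar>L t\<bar> + norm (F t 0))"
  define P where "P = (\<lambda>t. integral {0..t} l)"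
  define W where "W = (\<lambda>t. exp (2 * P t))"
  have contl: "continuous_on {0..} l"
    unfolding l_def by (intro continuous_intros cont contL)
  have l_nonneg: "0 \<le> l t" for t by (simp add: l_def)
  have P0: "P 0 = 0" by (simp add: P_def)
  have P_nonneg: "0 \<le> P t" for t
    unfolding P_def
    \<comment> \<open>A non-integrable function has integral \<open>0\<close> by convention, hence
      the case split.\<close>
    by (cases "l integrable_on {0..t}") (auto simp: integral_nonneg l_nonneg not_integrable_integral)
  have W_ge: "1 \<le> W t" for t using P_nonneg by (simp add: W_def)
  have W_pos: "0 < W t" for t by (simp add: W_def)
  have derW: "(W has_vector_derivative 2 * l t * W t) (at t within {0..})" if "0 \<le> t" for t
  proof -
    have "(P has_real_derivative l t) (at t within {0..})"
      using integral_has_vector_derivative_halfline[OF contl that]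
      by (simp add: P_def has_real_derivative_iff_has_vector_derivative)
    then show ?thesis
      unfolding W_def has_real_derivative_iff_has_vector_derivative[symmetric]
      by (auto intro!: derivative_eq_intros)
  qed
  have contW: "continuous_on {0..} W"
    using derW by (auto simp: continuous_on_eq_continuous_within intro: has_vector_derivative_continuous)
  have intW: "((\<lambda>s. l s * W s) has_integral (W t - 1) / 2) {0..t}" if "0 \<le> t" for t
  proof -
    have "((\<lambda>s. 2 * l s * W s) has_integral W t - W 0) {0..t}"
      by (intro fundamental_theorem_of_calculus that has_vector_derivative_within_subset[OF derW]) auto
    from has_integral_mult_right[OF this, of "1/2"] show ?thesis
      by (simp add: W_def P0)
  qed
  \<comment> \<open>The unknown is \<open>y = z / W\<close>, so the weighted norm of
    \<open>z\<close> is the plain supremum norm of \<open>y\<close>.\<close>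
  define A where "A = (\<lambda>y::real \<Rightarrow> 'a. \<lambda>t. z\<^sub>0 + integral {0..t} (\<lambda>s. F s (W s *\<^sub>R y s)))"
  have contF: "continuous_on {0..} (\<lambda>s. F s (W s *\<^sub>R y s))" if "continuous_on {0..} y" for y
    by (intro cont continuous_intros contW that)
  have derA: "(A y has_vector_derivative F t (W t *\<^sub>R y t)) (at t within {0..})"
    if "continuous_on {0..} y" "0 \<le> t" for y t
    using integral_has_vector_derivative_halfline[OF contF[OF that(1)] that(2)]
    unfolding A_def by (auto intro!: derivative_eq_intros)
  have contA: "continuous_on {0..} (A y)" if "continuous_on {0..} y" for y
    using derA[OF that] by (auto simp: continuous_on_eq_continuous_within intro: has_vector_derivative_continuous)
  have intF: "(\<lambda>s. F s (W s *\<^sub>R y s)) integrable_on {0..t}" if "continuous_on {0..} y" for y t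
    by (intro integrable_continuous_interval continuous_on_subset[OF contF[OF that]]) auto
  \<comment> \<open>The factor \<open>1/2\<close> of the contraction arises here, because
    \<open>l * W\<close> is half the derivative of \<open>W\<close>.\<close>
  have norm_int: "norm (integral {0..t} f) \<le> C * W t / 2"
    if "f integrable_on {0..t}" "\<And>s. 0 \<le> s \<Longrightarrow> norm (f s) \<le> C * (l s * W s)" "0 \<le> t" "0 \<le> C"
    for f :: "real \<Rightarrow> 'a" and C t
  proof -
    have *: "((\<lambda>s. C * (l s * W s)) has_integral C * ((W t - 1) / 2)) {0..t}"
      by (intro has_integral_mult_right intW that)
    have "norm (integral {0..t} f) \<le> C * ((W t - 1) / 2)"
      by (rule integral_norm_bound_integral[OF that(1) has_integral_integrable[OF *], unfolded integral_unique[OF *]])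
        (use that(2) in auto)
    also have "\<dots> \<le> C * W t / 2" using that(4) by (simp add: field_simps)
    finally show ?thesis .
  qed
  \<comment> \<open>Elements of \<open>bcontfun\<close> live on the whole real line;
    \<open>max 0 t\<close> continues the iterate constantly to negative times.\<close>
  define T where "T = (\<lambda>y t. (1 / W (max 0 t)) *\<^sub>R A y (max 0 t))"
  have T_bcont: "T (apply_bcontfun y) \<in> bcontfun" for y :: "real \<Rightarrow>\<^sub>C 'a"
  proof (rule bcontfun_normI)
    have cy: "continuous_on {0..} (apply_bcontfun y)" by simp
    have "continuous_on UNIV (\<lambda>t. W (max 0 t))" "continuous_on UNIV (\<lambda>t. A y (max 0 t))"
      by (auto intro!: continuous_on_compose2[OF contW] continuous_on_compose2[OF contA[OF cy]]
            continuous_intros)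
    then show "continuous_on UNIV (T (apply_bcontfun y))"
      unfolding T_def using W_pos by (intro continuous_intros) (auto simp: less_imp_neq[symmetric])
    fix t :: real
    define \<tau> where "\<tau> = max 0 t"
    have "norm (integral {0..\<tau>} (\<lambda>s. F s (W s *\<^sub>R y s))) \<le> (1 + norm y) * W \<tau> / 2"
    proof (rule norm_int[OF intF[OF cy]])
      fix s :: real assume s: "0 \<le> s"
      have "norm (F s (W s *\<^sub>R y s)) \<le> norm (F s 0) + norm (F s (W s *\<^sub>R y s) - F s 0)"
        using norm_triangle_sub by blast
      also have "\<dots> \<le> norm (F s 0) + \<bar>L s\<bar> * (W s * norm y)"
      proof -
        have "norm (F s (W s *\<^sub>R y s) - F s 0) \<le> L s * (W s * norm (y s))"
          using lip[OF s, of "W s *\<^sub>R y s" 0] W_pos[of s] by simp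
        also have "\<dots> \<le> \<bar>L s\<bar> * (W s * norm y)"
          using W_pos[of s] by (intro mult_mono norm_bounded) auto
        finally show ?thesis by simp
      qed
      also have "\<dots> \<le> l s * W s + l s * (W s * norm y)"
      proof (rule add_mono)
        have "norm (F s 0) * 1 \<le> l s * W s"
          using W_ge by (intro mult_mono) (auto simp: l_def)
        then show "norm (F s 0) \<le> l s * W s" by simp
        show "\<bar>L s\<bar> * (W s * norm y) \<le> l s * (W s * norm y)"
          using W_pos[of s] by (intro mult_right_mono) (auto simp: l_def)
      qed
      finally show "norm (F s (W s *\<^sub>R y s)) \<le> (1 + norm y) * (l s * W s)"
        by (simp add: algebra_simps)
    qed (auto simp: \<tau>_def)
    then have "norm (A y \<tau>) \<le> norm z\<^sub>0 + (1 + norm y) * W \<tau> / 2"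
      unfolding A_def by (meson add_left_mono norm_triangle_le order_trans norm_triangle_ineq)
    then have "norm (T y t) \<le> (norm z\<^sub>0 + (1 + norm y) * W \<tau> / 2) / W \<tau>"
      using W_pos[of \<tau>] by (simp add: T_def \<tau>_def[symmetric] divide_right_mono)
    also have "\<dots> \<le> norm z\<^sub>0 + (1 + norm y) / 2"
      using W_pos[of \<tau>] mult_left_mono[OF W_ge[of \<tau>], of "norm z\<^sub>0"] by (simp add: field_simps)
    finally show "norm (T y t) \<le> norm z\<^sub>0 + (1 + norm y) / 2" .
  qed
  have app: "apply_bcontfun (Bcontfun (T (apply_bcontfun y))) = T (apply_bcontfun y)" for y :: "real \<Rightarrow>\<^sub>C 'a"
    by (rule Bcontfun_inverse[OF T_bcont])
  have "\<exists>!y. Bcontfun (T (apply_bcontfun y)) = y"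
  proof (rule banach_fix_type[of "1/2"])
    show "\<forall>y z. dist (Bcontfun (T (apply_bcontfun y))) (Bcontfun (T (apply_bcontfun z))) \<le> 1 / 2 * dist y z"
    proof (intro allI dist_bound, unfold app)
      fix y z :: "real \<Rightarrow>\<^sub>C 'a" and t :: real
      define \<tau> where "\<tau> = max 0 t"
      have cy: "continuous_on {0..} (apply_bcontfun y)" "continuous_on {0..} (apply_bcontfun z)" by auto
      have "norm (integral {0..\<tau>} (\<lambda>s. F s (W s *\<^sub>R y s) - F s (W s *\<^sub>R z s))) \<le> dist y z * W \<tau> / 2"
      proof (rule norm_int)
        fix s :: real assume s: "0 \<le> s"
        have "norm (F s (W s *\<^sub>R y s) - F s (W s *\<^sub>R z s)) \<le> L s * (W s * dist (y s) (z s))"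
          using lip[OF s, of "W s *\<^sub>R y s" "W s *\<^sub>R z s"] W_pos[of s]
          by (simp add: scaleR_diff_right[symmetric] dist_norm)
        also have "\<dots> \<le> l s * (W s * dist y z)"
          using W_pos[of s] by (intro mult_mono dist_bounded) (auto simp: l_def add_increasing2)
        finally show "norm (F s (W s *\<^sub>R y s) - F s (W s *\<^sub>R z s)) \<le> dist y z * (l s * W s)"
          by (simp add: algebra_simps)
      qed (auto simp: \<tau>_def intro!: integrable_diff intF)
      then have le: "norm (A y \<tau> - A z \<tau>) \<le> dist y z * W \<tau> / 2"
        unfolding A_def by (simp add: integral_diff intF)
      have "dist (T y t) (T z t) = norm (A y \<tau> - A z \<tau>) / W \<tau>"
        using W_pos[of \<tau>] by (simp add: T_def \<tau>_def[symmetric] dist_norm scaleR_diff_right[symmetric])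
      then show "dist (T y t) (T z t) \<le> 1 / 2 * dist y z"
        using divide_right_mono[OF le, of "W \<tau>"] W_pos[of \<tau>] by simp
    qed
  qed auto
  then obtain y :: "real \<Rightarrow>\<^sub>C 'a" where y: "Bcontfun (T (apply_bcontfun y)) = y" by blast
  have cy: "continuous_on {0..} (apply_bcontfun y)" by simp
  \<comment> \<open>Undoing the scaling of the fixed point \<open>y\<close> gives
    \<open>A y\<close>, whose derivative is known; so \<open>A y\<close> is the solution.\<close>
  have fixpoint: "W t *\<^sub>R y t = A y t" if "0 \<le> t" for t
  proof -
    have "y t = T y t" using app[of y] y by simp
    then show ?thesis using that W_pos[of t] by (simp add: T_def)
  qed
  show ?thesis
  proof
    show "A y 0 = z\<^sub>0" by (simp add: A_def)
    show "(A y has_vector_derivative F t (A y t)) (at t within {0..})" if "0 \<le> t" for t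
      using derA[OF cy that] fixpoint[OF that] by simp
  qed
qed

section \<open>Scalar differential inequalities\<close>

lemma le_exp_of_deriv_le:
  fixes f f' :: "real \<Rightarrow> real"
  assumes cont: "continuous_on {0..} f"
    and der: "\<And>t. 0 < t \<Longrightarrow> (f has_real_derivative f' t) (at t)"
    and le: "\<And>t. 0 < t \<Longrightarrow> f' t \<le> c * f t"
    and "0 \<le> t"
  shows "f t \<le> exp (c * t) * f 0"
proof -
  \<comment> \<open>Integrating factor: \<open>exp (- c * s) * f s\<close> is nonincreasing. The
    inequality is available only at positive times; continuity brings in the value at
    \<open>0\<close>.\<close>
  have "exp (- c * t) * f t \<le> exp (- c * 0) * f 0"
  proof (rule DERIV_nonpos_imp_decreasing_open[OF \<open>0 \<le> t\<close>])
    fix s :: real assume "0 < s"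
    have "((\<lambda>s. exp (- c * s) * f s) has_real_derivative exp (- c * s) * (f' s - c * f s)) (at s)"
      by (auto intro!: derivative_eq_intros der[OF \<open>0 < s\<close>] simp: algebra_simps)
    moreover have "exp (- c * s) * (f' s - c * f s) \<le> 0"
      using le[OF \<open>0 < s\<close>] by (simp add: mult_nonneg_nonpos)
    ultimately show "\<exists>y. ((\<lambda>s. exp (- c * s) * f s) has_real_derivative y) (at s) \<and> y \<le> 0" by blast
  qed (auto intro!: continuous_intros continuous_on_subset[OF cont])
  then have "exp (c * t) * (exp (- c * t) * f t) \<le> exp (c * t) * f 0"
    by (intro mult_left_mono) auto
  then show ?thesis by (simp add: mult.assoc[symmetric] exp_add[symmetric])
qed

text \<open>The excess over the equilibrium \<open>k / m\<close> obeys a linear inequality with rate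
  \<open>- m\<close>, so it is at most a decaying multiple of its initial value.\<close>

lemma le_max_of_deriv_le:
  fixes f f' :: "real \<Rightarrow> real"
  assumes cont: "continuous_on {0..} f"
    and der: "\<And>t. 0 < t \<Longrightarrow> (f has_real_derivative f' t) (at t)"
    and le: "\<And>t. 0 < t \<Longrightarrow> f' t \<le> k - m * f t"
    and "0 < m" "0 \<le> t"
  shows "f t \<le> max (f 0) (k / m)"
proof -
  have "f t - k / m \<le> exp (- m * t) * (f 0 - k / m)"
  proof (rule le_exp_of_deriv_le[where f = "\<lambda>t. f t - k / m" and f' = f'])
    show "f' t \<le> - m * (f t - k / m)" if "0 < t" for t
      using le[OF that] \<open>0 < m\<close> by (simp add: algebra_simps)
  qed (auto intro!: derivative_eq_intros continuous_intros cont der \<open>0 \<le> t\<close>)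
  also have "\<dots> \<le> max (f 0 - k / m) 0"
  proof (cases "f 0 \<le> k / m")
    case False
    then have "exp (- m * t) * (f 0 - k / m) \<le> 1 * (f 0 - k / m)"
      using \<open>0 < m\<close> \<open>0 \<le> t\<close> by (intro mult_right_mono) auto
    then show ?thesis by simp
  qed (auto simp: mult_nonneg_nonpos)
  finally show ?thesis by (simp add: max_def split: if_splits)
qed

text \<open>Since \<open>f\<close> starts at \<open>0\<close>, integrating the bound on its
  derivative gains the factor \<open>1 / c\<close>. With \<open>c = 2 * L\<close> this yields the
  halving in the uniqueness proof.\<close>

lemma abs_le_exp_of_deriv_le:
  fixes f f' :: "real \<Rightarrow> real"
  assumes cont: "continuous_on {0..T} f" and "f 0 = 0"
    and der: "\<And>t. 0 < t \<Longrightarrow> t < T \<Longrightarrow> (f has_real_derivative f' t) (at t)"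
    and le: "\<And>t. 0 < t \<Longrightarrow> t < T \<Longrightarrow> \<bar>f' t\<bar> \<le> C * exp (c * t)"
    and "0 < c" "0 \<le> C" "0 \<le> t" "t \<le> T"
  shows "\<bar>f t\<bar> \<le> C / c * exp (c * t)"
proof -
  \<comment> \<open>The sign \<open>\<sigma>\<close> treats \<open>f\<close> and \<open>- f\<close>
    at once.\<close>
  have key: "\<sigma> * f t \<le> C / c * exp (c * t)" if \<sigma>: "\<bar>\<sigma>\<bar> = 1" for \<sigma>
  proof -
    have "\<sigma> * f t - C / c * exp (c * t) \<le> \<sigma> * f 0 - C / c * exp (c * 0)"
    proof (rule DERIV_nonpos_imp_decreasing_open[OF \<open>0 \<le> t\<close>])
      fix s :: real assume s: "0 < s" "s < t"
      with \<open>t \<le> T\<close> have sT: "s < T" by simp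
      have "((\<lambda>s. \<sigma> * f s - C / c * exp (c * s)) has_real_derivative \<sigma> * f' s - C * exp (c * s)) (at s)"
        using \<open>0 < c\<close> by (auto intro!: derivative_eq_intros der s(1) sT)
      moreover have "\<sigma> * f' s \<le> \<bar>f' s\<bar>"
        using abs_ge_self[of "\<sigma> * f' s"] \<sigma> by (simp add: abs_mult)
      ultimately show "\<exists>y. ((\<lambda>s. \<sigma> * f s - C / c * exp (c * s)) has_real_derivative y) (at s) \<and> y \<le> 0"
        using le[OF s(1) sT] by (intro exI conjI) auto
    qed (use \<open>t \<le> T\<close> \<open>0 < c\<close> in \<open>auto intro!: continuous_intros continuous_on_subset[OF cont]\<close>)
    moreover have "0 \<le> C / c" using \<open>0 < c\<close> \<open>0 \<le> C\<close> by simp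
    ultimately show ?thesis using \<open>f 0 = 0\<close> by simp
  qed
  show ?thesis using key[of 1] key[of "-1"] by (simp add: abs_le_iff)
qed

text \<open>A zero with positive derivative is preceded by negative values, and these force an
  earlier zero by the intermediate value theorem; hence there is no first zero.\<close>

lemma pos_of_deriv_pos_at_zeros:
  fixes f :: "real \<Rightarrow> real"
  assumes cont: "continuous_on {0..} f" and "0 < f 0"
    and der: "\<And>t. 0 < t \<Longrightarrow> f t = 0 \<Longrightarrow> \<exists>D>0. (f has_real_derivative D) (at t)"
    and "0 \<le> t"
  shows "0 < f t"
proof (rule ccontr)
  assume "\<not> 0 < f t"
  define Z where "Z = {s \<in> {0..t}. f s = 0}"
  have ex_zero: "\<exists>r\<ge>0. r \<le> s \<and> f r = 0" if "f s \<le> 0" "0 \<le> s" for s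
    using IVT2'[of f s 0 0] that \<open>0 < f 0\<close> continuous_on_subset[OF cont, of "{0..s}"] by auto
  have "Z \<noteq> {}" using ex_zero[of t] \<open>\<not> 0 < f t\<close> \<open>0 \<le> t\<close> by (auto simp: Z_def)
  moreover have "closed Z"
    unfolding Z_def
    by (rule continuous_closed_preimage_constant) (auto intro: continuous_on_subset[OF cont])
  moreover have bdd: "bdd_below Z" by (auto simp: Z_def intro: bdd_belowI[of _ 0])
  ultimately have "Inf Z \<in> Z" by (intro closed_contains_Inf)
  then have s: "0 \<le> Inf Z" "Inf Z \<le> t" "f (Inf Z) = 0" by (auto simp: Z_def)
  with \<open>0 < f 0\<close> have "0 < Inf Z" by (metis less_irrefl order_le_less)
  then obtain D where "0 < D" "(f has_real_derivative D) (at (Inf Z))" using der s(3) by blast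
  then obtain e where e: "0 < e" "\<And>h. 0 < h \<Longrightarrow> h < e \<Longrightarrow> f (Inf Z - h) < 0"
    using DERIV_pos_inc_left[of f D "Inf Z"] s(3) by auto
  \<comment> \<open>Halving keeps \<open>h\<close> strictly below both \<open>e\<close> and
    \<open>Inf Z\<close>, so \<open>Inf Z - h\<close> is a positive time at which \<open>f\<close>
    is negative.\<close>
  define h where "h = min (e / 2) (Inf Z / 2)"
  have h: "0 < h" "h < e" "h < Inf Z" using e(1) \<open>0 < Inf Z\<close> by (auto simp: h_def min_def)
  then obtain r where "0 \<le> r" "r \<le> Inf Z - h" "f r = 0"
    using ex_zero[of "Inf Z - h"] e(2)[of h] by auto
  moreover then have "r \<in> Z" using h s by (auto simp: Z_def)
  then have "Inf Z \<le> r" using bdd by (rule cInf_lower)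
  ultimately show False using h by linarith
qed

lemma at_within_halfline: "0 < t \<Longrightarrow> at t within {0..} = at (t::real)"
  by (rule at_within_interior) (simp add: interior_real_atLeast)

subsection \<open>The truncated system\<close>

text \<open>Makes \<open>picard_halfline\<close> applicable to pairs of a bounded continuous
  function and a real number.\<close>

instance bcontfun :: (metric_space, banach) banach ..

text \<open>Point evaluation turns time derivatives in the supremum norm into pointwise
  ones.\<close>

lemma bounded_linear_apply_bcontfun:
  "bounded_linear (\<lambda>f::'a::topological_space \<Rightarrow>\<^sub>C 'b::real_normed_vector. f x)"
proof (rule bounded_linear_intro[where K = 1])
  show "norm (f x) \<le> norm f * 1" for f :: "'a \<Rightarrow>\<^sub>C 'b" using norm_bounded[of f x] by simp
qed auto

section \<open>Scalar truncation and the saturating growth term\<close>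

definition trunc :: "real \<Rightarrow> real \<Rightarrow> real" where
  "trunc r c = max 0 (min r c)"

lemma trunc_nonneg: "0 \<le> trunc r c" and trunc_le: "0 \<le> r \<Longrightarrow> trunc r c \<le> r"
  by (auto simp: trunc_def)

lemma trunc_eq: "0 \<le> c \<Longrightarrow> c \<le> r \<Longrightarrow> trunc r c = c"
  by (auto simp: trunc_def)

lemma trunc_le_self: "0 \<le> c \<Longrightarrow> trunc r c \<le> c"
  by (auto simp: trunc_def)

text \<open>The level varies along with the argument because the cut-off depends on time.\<close>

lemma trunc_lipschitz: "\<bar>trunc r c - trunc r' c'\<bar> \<le> \<bar>c - c'\<bar> + \<bar>r - r'\<bar>"
  by (auto simp: trunc_def max_def min_def abs_if)

lemma continuous_on_trunc [continuous_intros]: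
  "continuous_on S f \<Longrightarrow> continuous_on S (\<lambda>x. trunc r (f x))"
  unfolding trunc_def by (intro continuous_intros)

text \<open>The growth term of the equation for \<open>u\<close> without the factor
  \<open>a\<close>, with \<open>c\<close> standing for \<open>u\<close> and \<open>z\<close> for
  \<open>\<xi>\<close>.\<close>

definition uptake :: "real \<Rightarrow> real \<Rightarrow> real" where
  "uptake c z = c\<^sup>2 * z / (1 + c * z)"

lemma uptake_nonneg: "0 \<le> c \<Longrightarrow> 0 \<le> z \<Longrightarrow> 0 \<le> uptake c z"
  by (simp add: uptake_def)

lemma uptake_le: assumes "0 \<le> c" "0 \<le> z" shows "uptake c z \<le> c"
proof -
  have "0 < 1 + c * z" using assms by (simp add: add_pos_nonneg)
  then show ?thesis using assms by (simp add: uptake_def field_simps power2_eq_square)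
qed

lemma uptake_le_square: assumes "0 \<le> c" "0 \<le> z" shows "uptake c z \<le> z * c\<^sup>2"
proof -
  have "1 \<le> 1 + c * z" using assms by simp
  moreover from this have "0 < 1 + c * z" by linarith
  ultimately have "c\<^sup>2 * z / (1 + c * z) \<le> c\<^sup>2 * z / 1"
    using assms by (intro divide_left_mono mult_pos_pos) auto
  then show ?thesis by (simp add: uptake_def mult.commute)
qed

text \<open>The arguments change one at a time, through \<open>uptake c' z\<close>. In the first,
  \<open>uptake c z = c - c / (1 + c * z)\<close> shows that the difference is \<open>c - c'\<close>
  times a factor in \<open>[0, 1]\<close>; in the second, it is \<open>z - z'\<close> times at most
  \<open>c'\<^sup>2\<close>.\<close>

lemma uptake_lipschitz:
  assumes "0 \<le> c" "0 \<le> c'" "c' \<le> B" "0 \<le> z" "0 \<le> z'"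
  shows "\<bar>uptake c z - uptake c' z'\<bar> \<le> \<bar>c - c'\<bar> + B\<^sup>2 * \<bar>z - z'\<bar>"
proof -
  have ge: "1 \<le> 1 + c * z" "1 \<le> 1 + c' * z" "1 \<le> 1 + c' * z'" using assms by auto
  then have nz: "1 + c * z \<noteq> 0" "1 + c' * z \<noteq> 0" "1 + c' * z' \<noteq> 0" by linarith+
  have p: "1 \<le> (1 + c * z) * (1 + c' * z)" "1 \<le> (1 + c' * z) * (1 + c' * z')"
    using mult_mono[OF ge(1,2)] mult_mono[OF ge(2,3)] ge by auto
  have "uptake c z = c - c / (1 + c * z)" "uptake c' z = c' - c' / (1 + c' * z)"
    using nz by (auto simp: uptake_def field_simps power2_eq_square)
  moreover have "c / (1 + c * z) - c' / (1 + c' * z) = (c - c') * (1 / ((1 + c * z) * (1 + c' * z)))"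
    using nz by (simp add: diff_frac_eq) (simp add: algebra_simps)
  ultimately have "uptake c z - uptake c' z = (c - c') * (1 - 1 / ((1 + c * z) * (1 + c' * z)))"
    unfolding right_diff_distrib mult_1_right by linarith
  moreover have "\<bar>1 - 1 / ((1 + c * z) * (1 + c' * z))\<bar> \<le> 1"
    using p(1) by (simp add: abs_le_iff)
  ultimately have 1: "\<bar>uptake c z - uptake c' z\<bar> \<le> \<bar>c - c'\<bar>"
    by (simp add: abs_mult mult_left_le)
  have "uptake c' z - uptake c' z' = c'\<^sup>2 * (z - z') / ((1 + c' * z) * (1 + c' * z'))"
    using nz by (simp add: uptake_def diff_frac_eq) (simp add: algebra_simps power2_eq_square)
  then have "\<bar>uptake c' z - uptake c' z'\<bar> = c'\<^sup>2 * \<bar>z - z'\<bar> / ((1 + c' * z) * (1 + c' * z'))"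
    using ge by (simp add: abs_mult)
  also have "\<dots> \<le> c'\<^sup>2 * \<bar>z - z'\<bar> / 1"
    using p(2) by (intro divide_left_mono) auto
  also have "\<dots> \<le> B\<^sup>2 * \<bar>z - z'\<bar>"
    using assms by (simp add: mult_right_mono power_mono)
  finally show ?thesis using 1 by linarith
qed

lemma abs_diff_squares_le:
  fixes c c' B :: real
  assumes "0 \<le> c" "c \<le> B" "0 \<le> c'" "c' \<le> B"
  shows "\<bar>c\<^sup>2 - c'\<^sup>2\<bar> \<le> 2 * B * \<bar>c - c'\<bar>"
proof -
  have "\<bar>c\<^sup>2 - c'\<^sup>2\<bar> = (c + c') * \<bar>c - c'\<bar>"
    using assms by (simp add: power2_eq_square square_diff_square_factored abs_mult)
  also have "\<dots> \<le> 2 * B * \<bar>c - c'\<bar>" using assms by (intro mult_right_mono) auto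
  finally show ?thesis .
qed

lemma abs_diff_products_le:
  fixes z z' I J K :: real
  assumes "0 \<le> z'" "z' \<le> K" "\<bar>I\<bar> \<le> Q"
  shows "\<bar>z * I - z' * J\<bar> \<le> \<bar>z - z'\<bar> * Q + K * \<bar>I - J\<bar>"
proof -
  have "z * I - z' * J = (z - z') * I + z' * (I - J)" by (simp add: algebra_simps)
  then have "\<bar>z * I - z' * J\<bar> \<le> \<bar>z - z'\<bar> * \<bar>I\<bar> + z' * \<bar>I - J\<bar>"
    using abs_triangle_ineq[of "(z - z') * I" "z' * (I - J)"] assms(1) by (simp add: abs_mult)
  also have "\<dots> \<le> \<bar>z - z'\<bar> * Q + K * \<bar>I - J\<bar>"
    using assms by (intro add_mono mult_left_mono mult_right_mono) auto
  finally show ?thesis .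
qed

section \<open>Integration over a domain of unit measure\<close>

locale resource_model =
  fixes \<Omega> :: "(real ^ 'n) set" and a d \<kappa> :: real
  assumes bounded_dom: "bounded \<Omega>" and meas_dom: "\<Omega> \<in> sets lebesgue"
    and unit_measure: "measure lebesgue \<Omega> = 1"
    and a_pos: "0 < a" and d_pos: "0 < d" and \<kappa>_pos: "0 < \<kappa>"
begin

lemma fmeasurable_dom: "\<Omega> \<in> lmeasurable"
  using bounded_dom meas_dom by (rule bounded_set_imp_lmeasurable)

lemma set_integrable_dom:
  fixes f :: "real ^ 'n \<Rightarrow> real"
  assumes "continuous_on \<Omega> f" "\<And>x. x \<in> \<Omega> \<Longrightarrow> \<bar>f x\<bar> \<le> B"
  shows "set_integrable lebesgue \<Omega> f"
proof (rule measurable_bounded_by_integrable_imp_absolutely_integrable)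
  show "f \<in> borel_measurable (lebesgue_on \<Omega>)"
    by (rule continuous_imp_measurable_on_sets_lebesgue[OF assms(1) meas_dom])
  show "(\<lambda>x. B) integrable_on \<Omega>" by (rule integrable_on_const[OF fmeasurable_dom])
qed (use meas_dom assms(2) in auto)

text \<open>The unit measure enters here; it lets pointwise bounds pass to integrals without a
  volume factor.\<close>

lemma integral_const_dom: "(LINT x:\<Omega>|lebesgue. c) = (c::real)"
  using fmeasurable_dom unit_measure
  by (subst set_integral_const) (auto simp: fmeasurable_def less_top)

lemma set_integrable_const_dom: "set_integrable lebesgue \<Omega> (\<lambda>x. c::real)"
  by (rule set_integrable_dom[where B = "\<bar>c\<bar>"]) auto

lemma integral_le_dom:
  fixes f :: "real ^ 'n \<Rightarrow> real"
  assumes "set_integrable lebesgue \<Omega> f" "\<And>x. x \<in> \<Omega> \<Longrightarrow> f x \<le> C"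
  shows "(LINT x:\<Omega>|lebesgue. f x) \<le> C"
  using set_integral_mono[OF assms(1) set_integrable_const_dom assms(2)] by (simp add: integral_const_dom)

lemma integral_ge_dom:
  fixes f :: "real ^ 'n \<Rightarrow> real"
  assumes "set_integrable lebesgue \<Omega> f" "\<And>x. x \<in> \<Omega> \<Longrightarrow> C \<le> f x"
  shows "C \<le> (LINT x:\<Omega>|lebesgue. f x)"
  using set_integral_mono[OF set_integrable_const_dom assms(1) assms(2)] by (simp add: integral_const_dom)

lemma abs_integral_diff_le_dom:
  fixes f g :: "real ^ 'n \<Rightarrow> real"
  assumes "set_integrable lebesgue \<Omega> f" "set_integrable lebesgue \<Omega> g"
    and "\<And>x. x \<in> \<Omega> \<Longrightarrow> \<bar>f x - g x\<bar> \<le> C"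
  shows "\<bar>(LINT x:\<Omega>|lebesgue. f x) - (LINT x:\<Omega>|lebesgue. g x)\<bar> \<le> C"
proof -
  have "\<bar>LINT x:\<Omega>|lebesgue. f x - g x\<bar> \<le> C"
    unfolding abs_le_iff minus_le_iff[of _ C]
  proof (intro conjI integral_le_dom integral_ge_dom set_integral_diff(1)[OF assms(1,2)])
    fix x assume "x \<in> \<Omega>"
    then show "f x - g x \<le> C" "- C \<le> f x - g x" using assms(3)[of x] by linarith+
  qed
  then show ?thesis using set_integral_diff(2)[OF assms(1,2)] by simp
qed

lemma set_integrable_bcontfun: "set_integrable lebesgue \<Omega> (apply_bcontfun w)"
  for w :: "(real ^ 'n) \<Rightarrow>\<^sub>C real"
  using norm_bounded[of w] by (intro set_integrable_dom[where B = "norm w"]) auto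

text \<open>A bounded linear functional commutes with the time derivative in the supremum norm,
  which replaces differentiation under the integral sign.\<close>

lemma bounded_linear_integral_dom:
  "bounded_linear (\<lambda>w::(real ^ 'n) \<Rightarrow>\<^sub>C real. LINT x:\<Omega>|lebesgue. w x)"
proof (rule bounded_linear_intro[where K = 1])
  fix v w :: "(real ^ 'n) \<Rightarrow>\<^sub>C real" and r :: real
  show "(LINT x:\<Omega>|lebesgue. (v + w) x) = (LINT x:\<Omega>|lebesgue. v x) + (LINT x:\<Omega>|lebesgue. w x)"
    by (simp add: set_integrable_bcontfun)
  show "(LINT x:\<Omega>|lebesgue. (r *\<^sub>R v) x) = r *\<^sub>R (LINT x:\<Omega>|lebesgue. v x)"
    by simp
  show "norm (LINT x:\<Omega>|lebesgue. v x) \<le> norm v * 1"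
    using abs_integral_diff_le_dom[of v "\<lambda>x. 0" "norm v"] norm_bounded[of v]
      set_integrable_bcontfun[of v] set_integrable_const_dom[of 0] by simp
qed

section \<open>The truncated vector field and its Lipschitz estimates\<close>

definition trunc_rate :: "real \<Rightarrow> real \<Rightarrow> ((real ^ 'n) \<Rightarrow>\<^sub>C real) \<times> real \<Rightarrow> real ^ 'n \<Rightarrow> real" where
  "trunc_rate K r z = (\<lambda>x. a * uptake (trunc r (fst z x)) (trunc K (snd z)) - d * fst z x)"

definition trunc_mass :: "real \<Rightarrow> ((real ^ 'n) \<Rightarrow>\<^sub>C real) \<Rightarrow> real" where
  "trunc_mass r w = (LINT x:\<Omega>|lebesgue. (trunc r (w x))\<^sup>2)"

text \<open>
  The vector field of the system on \<open>C\<^sub>b(\<real>\<^sup>n) \<times> \<real>\<close>, truncated outside \<open>0 \<le> u \<le> r\<close>, \<open>0 \<le> \<xi> \<le> K\<close>.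
  The linear terms stay untruncated, so that the a priori bounds hold for the truncated system too.
\<close>

definition trunc_field ::
    "real \<Rightarrow> real \<Rightarrow> ((real ^ 'n) \<Rightarrow>\<^sub>C real) \<times> real \<Rightarrow> ((real ^ 'n) \<Rightarrow>\<^sub>C real) \<times> real" where
  "trunc_field K r z =
     (Bcontfun (trunc_rate K r z), \<kappa> - snd z - trunc K (snd z) * trunc_mass r (fst z))"

text \<open>\<open>Bcontfun\<close> can be unfolded only on bounded continuous functions. Truncation
  provides both properties: denominators are at least \<open>1\<close> and the uptake is at most
  \<open>r\<close>.\<close>

lemma apply_trunc_field:
  assumes "0 \<le> r"
  shows "apply_bcontfun (fst (trunc_field K r z)) = trunc_rate K r z"
proof -
  have "trunc_rate K r z \<in> bcontfun"
  proof (rule bcontfun_normI)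
    have "1 + trunc r (fst z x) * trunc K (snd z) \<noteq> 0" for x
      using trunc_nonneg[of r "fst z x"] trunc_nonneg[of K "snd z"]
      by (metis add_pos_nonneg less_irrefl mult_nonneg_nonneg zero_less_one)
    then show "continuous_on UNIV (trunc_rate K r z)"
      unfolding trunc_rate_def uptake_def by (intro continuous_intros) auto
    show "norm (trunc_rate K r z x) \<le> a * r + d * norm (fst z)" for x
    proof -
      have "\<bar>uptake (trunc r (fst z x)) (trunc K (snd z))\<bar> \<le> r"
        using uptake_nonneg[OF trunc_nonneg trunc_nonneg, of r "fst z x" K "snd z"]
          uptake_le[OF trunc_nonneg trunc_nonneg, of r "fst z x" K "snd z"] trunc_le[OF assms, of "fst z x"]
        by linarith
      then have "\<bar>a * uptake (trunc r (fst z x)) (trunc K (snd z))\<bar> \<le> a * r"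
        using a_pos by (simp add: abs_mult)
      moreover have "\<bar>d * fst z x\<bar> \<le> d * norm (fst z)"
        using d_pos norm_bounded[of "fst z" x] by (simp add: abs_mult)
      ultimately show ?thesis by (simp add: trunc_rate_def)
    qed
  qed
  then show ?thesis by (simp add: trunc_field_def Bcontfun_inverse)
qed

text \<open>The sum of the constants of the two components, in \<open>rate_difference_le\<close> and
  \<open>resource_difference_le\<close>.\<close>

definition lip_const :: "real \<Rightarrow> real \<Rightarrow> real" where
  "lip_const K B = a + d + 1 + (a + 1) * B\<^sup>2 + 2 * K * B"

text \<open>The arguments \<open>c\<close> of the nonlinear term and \<open>v\<close> of the linear
  term are separate, since only the former is truncated; the uniqueness proof takes them
  equal.\<close>

lemma rate_difference_le:
  assumes "0 \<le> c" "0 \<le> c'" "c' \<le> B" "0 \<le> z" "0 \<le> z'" "\<bar>c - c'\<bar> \<le> m" "\<bar>z - z'\<bar> \<le> m" "\<bar>v - v'\<bar> \<le> m"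
  shows "\<bar>(a * uptake c z - d * v) - (a * uptake c' z' - d * v')\<bar> \<le> (a + d + a * B\<^sup>2) * m"
proof -
  have "\<bar>uptake c z - uptake c' z'\<bar> \<le> m + B\<^sup>2 * m"
    using uptake_lipschitz[OF assms(1-5)] assms(6) mult_left_mono[OF assms(7), of "B\<^sup>2"] by simp
  then have "\<bar>a * (uptake c z - uptake c' z')\<bar> \<le> a * (m + B\<^sup>2 * m)"
    using a_pos by (simp add: abs_mult)
  moreover have "\<bar>d * (v - v')\<bar> \<le> d * m" using d_pos assms(8) by (simp add: abs_mult)
  ultimately show ?thesis by (simp add: algebra_simps)
qed

text \<open>On \<open>[0, B]\<close> squaring is Lipschitz with constant \<open>2 * B\<close>, and
  integration over unit measure keeps this constant. As before, \<open>z\<close> may be truncated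
  while \<open>y\<close> is not.\<close>

lemma resource_difference_le:
  assumes f: "continuous_on \<Omega> f" "\<And>x. x \<in> \<Omega> \<Longrightarrow> 0 \<le> f x \<and> f x \<le> B"
    and g: "continuous_on \<Omega> g" "\<And>x. x \<in> \<Omega> \<Longrightarrow> 0 \<le> g x \<and> g x \<le> B"
    and fg: "\<And>x. x \<in> \<Omega> \<Longrightarrow> \<bar>f x - g x\<bar> \<le> m"
    and "0 \<le> B" "0 \<le> z'" "z' \<le> K" "\<bar>z - z'\<bar> \<le> m" "\<bar>y - y'\<bar> \<le> m"
  shows "\<bar>(\<kappa> - y - z * (LINT x:\<Omega>|lebesgue. (f x)\<^sup>2)) - (\<kappa> - y' - z' * (LINT x:\<Omega>|lebesgue. (g x)\<^sup>2))\<bar>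
    \<le> (1 + B\<^sup>2 + 2 * K * B) * m"
proof -
  have sq: "(f x)\<^sup>2 \<le> B\<^sup>2" "(g x)\<^sup>2 \<le> B\<^sup>2" if "x \<in> \<Omega>" for x
    using f(2) g(2) that by (auto intro: power_mono)
  have int: "set_integrable lebesgue \<Omega> (\<lambda>x. (f x)\<^sup>2)" "set_integrable lebesgue \<Omega> (\<lambda>x. (g x)\<^sup>2)"
    using sq by (auto intro!: set_integrable_dom[where B = "B\<^sup>2"] continuous_intros f(1) g(1))
  let ?I = "LINT x:\<Omega>|lebesgue. (f x)\<^sup>2" and ?J = "LINT x:\<Omega>|lebesgue. (g x)\<^sup>2"
  have I: "\<bar>?I\<bar> \<le> B\<^sup>2"
    using integral_le_dom[OF int(1) sq(1)] integral_ge_dom[OF int(1), of 0] by simp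
  have "\<bar>?I - ?J\<bar> \<le> 2 * B * m"
  proof (rule abs_integral_diff_le_dom[OF int])
    fix x assume x: "x \<in> \<Omega>"
    have "\<bar>(f x)\<^sup>2 - (g x)\<^sup>2\<bar> \<le> 2 * B * \<bar>f x - g x\<bar>"
      using f(2)[OF x] g(2)[OF x] by (intro abs_diff_squares_le) auto
    also have "\<dots> \<le> 2 * B * m" using fg[OF x] \<open>0 \<le> B\<close> by (intro mult_left_mono) auto
    finally show "\<bar>(f x)\<^sup>2 - (g x)\<^sup>2\<bar> \<le> 2 * B * m" .
  qed
  then have "K * \<bar>?I - ?J\<bar> \<le> K * (2 * B * m)"
    using assms(7,8) by (intro mult_left_mono) auto
  moreover have "\<bar>z - z'\<bar> * B\<^sup>2 \<le> m * B\<^sup>2" using assms(9) by (intro mult_right_mono) auto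
  moreover have "\<bar>z * ?I - z' * ?J\<bar> \<le> \<bar>z - z'\<bar> * B\<^sup>2 + K * \<bar>?I - ?J\<bar>"
    using assms(7,8) I by (rule abs_diff_products_le)
  ultimately have "\<bar>z * ?I - z' * ?J\<bar> \<le> m * B\<^sup>2 + K * (2 * B * m)" by linarith
  then show ?thesis using assms(10) by (simp add: algebra_simps abs_le_iff)
qed

text \<open>Equal levels give the Lipschitz estimate in the state, different levels the continuity
  in time.\<close>

lemma trunc_field_difference_le:
  assumes r: "0 \<le> r" "r \<le> B" and r': "0 \<le> r'" "r' \<le> B" and "0 \<le> K"
  shows "norm (trunc_field K r y - trunc_field K r' z) \<le> lip_const K B * (norm (y - z) + \<bar>r - r'\<bar>)"
proof -
  define m where "m = norm (y - z) + \<bar>r - r'\<bar>"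
  have v: "\<bar>fst y x - fst z x\<bar> \<le> norm (y - z)" for x
    using norm_bounded[of "fst y - fst z" x] norm_fst_le[of "fst (y - z)" "snd (y - z)", unfolded prod.collapse] by simp
  have s: "\<bar>snd y - snd z\<bar> \<le> norm (y - z)"
    using norm_snd_le[of "snd (y - z)" "fst (y - z)", unfolded prod.collapse] by simp
  have c: "\<bar>trunc r (fst y x) - trunc r' (fst z x)\<bar> \<le> m" for x
    using trunc_lipschitz[of r "fst y x" r' "fst z x"] v[of x] by (simp add: m_def)
  have k: "\<bar>trunc K (snd y) - trunc K (snd z)\<bar> \<le> m"
    using trunc_lipschitz[of K "snd y" K "snd z"] s by (simp add: m_def)
  have "norm (fst (trunc_field K r y) - fst (trunc_field K r' z)) \<le> (a + d + a * B\<^sup>2) * m"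
  proof (rule norm_bound)
    fix x
    show "norm ((fst (trunc_field K r y) - fst (trunc_field K r' z)) x) \<le> (a + d + a * B\<^sup>2) * m"
      using rate_difference_le[OF trunc_nonneg trunc_nonneg order_trans[OF trunc_le[OF r'(1)] r'(2)]
          trunc_nonneg trunc_nonneg c k, of "fst y x" "fst z x"] v[of x]
      by (simp add: apply_trunc_field[OF r(1)] apply_trunc_field[OF r'(1)] trunc_rate_def m_def)
  qed
  moreover have "norm (snd (trunc_field K r y) - snd (trunc_field K r' z)) \<le> (1 + B\<^sup>2 + 2 * K * B) * m"
    unfolding trunc_field_def snd_conv trunc_mass_def real_norm_def
  proof (rule resource_difference_le)
    show "0 \<le> trunc r (fst y x) \<and> trunc r (fst y x) \<le> B" for x
      using trunc_nonneg trunc_le[OF r(1), of "fst y x"] r(2) by auto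
    show "0 \<le> trunc r' (fst z x) \<and> trunc r' (fst z x) \<le> B" for x
      using trunc_nonneg trunc_le[OF r'(1), of "fst z x"] r'(2) by auto
    show "\<bar>snd y - snd z\<bar> \<le> m" using s by (simp add: m_def)
  qed (use r \<open>0 \<le> K\<close> c k in \<open>auto intro!: continuous_intros trunc_nonneg trunc_le\<close>)
  ultimately have "norm (trunc_field K r y - trunc_field K r' z)
      \<le> (a + d + a * B\<^sup>2) * m + (1 + B\<^sup>2 + 2 * K * B) * m"
    using norm_Pair_le[of "fst (trunc_field K r y - trunc_field K r' z)"
        "snd (trunc_field K r y - trunc_field K r' z)", unfolded prod.collapse] by simp
  also have "\<dots> = lip_const K B * m" by (simp add: lip_const_def algebra_simps)
  finally show ?thesis by (simp add: m_def)
qed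

text \<open>Continuity of the field along the flow is exported because it makes the time derivatives
  of the solution continuous.\<close>

lemma trunc_flow_exists:
  assumes "0 \<le> K" "0 \<le> M"
  obtains z where "z 0 = z\<^sub>0"
    and "\<And>t. 0 \<le> t \<Longrightarrow>
      (z has_vector_derivative trunc_field K (M * exp (a * t)) (z t)) (at t within {0..})"
    and "continuous_on {0..} (\<lambda>t. trunc_field K (M * exp (a * t)) (z t))"
proof -
  let ?R = "\<lambda>t. M * exp (a * t)"
  have cont: "continuous_on {0..} (\<lambda>t. trunc_field K (?R t) (z t))" if "continuous_on {0..} z" for z
    unfolding continuous_on_def
  proof
    fix t :: real assume "t \<in> {0..}"
    \<comment> \<open>The sum \<open>?R s + ?R t\<close> bounds both levels and is continuous in
      \<open>s\<close>, so the difference estimate tends to \<open>0\<close> as \<open>s\<close>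
      tends to \<open>t\<close>.\<close>
    have "((\<lambda>s. lip_const K (?R s + ?R t) * (norm (z s - z t) + \<bar>?R s - ?R t\<bar>)) \<longlongrightarrow>
        lip_const K (?R t + ?R t) * (norm (z t - z t) + \<bar>?R t - ?R t\<bar>)) (at t within {0..})"
      unfolding lip_const_def
      using that \<open>t \<in> {0..}\<close> by (intro tendsto_intros) (auto simp: continuous_on_def)
    then have "((\<lambda>s. lip_const K (?R s + ?R t) * (norm (z s - z t) + \<bar>?R s - ?R t\<bar>)) \<longlongrightarrow> 0)
        (at t within {0..})" by simp
    then have "((\<lambda>s. trunc_field K (?R s) (z s) - trunc_field K (?R t) (z t)) \<longlongrightarrow> 0) (at t within {0..})"
      by (rule Lim_null_comparison[rotated])
        (use assms in \<open>auto intro!: always_eventually trunc_field_difference_le\<close>)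
    then show "((\<lambda>t. trunc_field K (?R t) (z t)) \<longlongrightarrow> trunc_field K (?R t) (z t)) (at t within {0..})"
      by (simp add: Lim_null[symmetric])
  qed
  have lip: "norm (trunc_field K (?R t) y - trunc_field K (?R t) z) \<le> lip_const K (?R t) * norm (y - z)"
    for t y z
    using trunc_field_difference_le[of "?R t" "?R t" "?R t" K y z] assms by simp
  obtain z where z: "z 0 = z\<^sub>0"
      "\<And>t. 0 \<le> t \<Longrightarrow> (z has_vector_derivative trunc_field K (?R t) (z t)) (at t within {0..})"
  proof (rule picard_halfline[of "\<lambda>t. trunc_field K (?R t)" "\<lambda>t. lip_const K (?R t)" z\<^sub>0])
    show "continuous_on {0..} (\<lambda>t. lip_const K (?R t))"
      unfolding lip_const_def by (intro continuous_intros)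
  qed (erule cont | rule lip | fast)+
  moreover have "continuous_on {0..} z"
    using z(2) by (auto simp: continuous_on_eq_continuous_within intro: has_vector_derivative_continuous)
  ultimately show ?thesis using cont that by blast
qed

subsection \<open>A priori bounds, uniqueness and existence\<close>

lemma solution_continuous:
  assumes "nonneg_global_solution \<Omega> a d \<kappa> u\<^sub>0 \<xi>\<^sub>0 u \<xi>"
  shows "x \<in> closure \<Omega> \<Longrightarrow> continuous_on {0..} (u x)" and "continuous_on {0..} \<xi>"
    and "0 \<le> t \<Longrightarrow> continuous_on (closure \<Omega>) (\<lambda>x. u x t)"
proof -
  have u: "C_time_space \<Omega> u" "C1_halfline \<xi>" using assms by (auto simp: nonneg_global_solution_def)
  show "continuous_on {0..} (u x)" if "x \<in> closure \<Omega>"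
    unfolding continuous_on_def
  proof
    fix t :: real assume "t \<in> {0..}"
    then show "(u x \<longlongrightarrow> u x t) (at t within {0..})"
      using u(1) that tendsto_uniform_limitI[where f = "\<lambda>s x. u x s" and l = "\<lambda>x. u x t"]
      by (auto simp: C_time_space_def)
  qed
  show "continuous_on {0..} \<xi>"
    using u(2) unfolding C1_halfline_def continuous_on_eq_continuous_within
    by (auto intro: DERIV_continuous)
  show "0 \<le> t \<Longrightarrow> continuous_on (closure \<Omega>) (\<lambda>x. u x t)"
    using u(1) by (auto simp: C_time_space_def)
qed

lemma rate_eq_uptake: "(a * c * z / (1 + c * z) - d) * c = a * uptake c z - d * c"
  by (simp add: uptake_def left_diff_distrib power2_eq_square)

lemma solution_deriv:
  assumes "nonneg_global_solution \<Omega> a d \<kappa> u\<^sub>0 \<xi>\<^sub>0 u \<xi>" "0 < t"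
  shows "x \<in> \<Omega> \<Longrightarrow> (u x has_real_derivative a * uptake (u x t) (\<xi> t) - d * u x t) (at t)"
    and "(\<xi> has_real_derivative \<kappa> - \<xi> t - \<xi> t * (LINT x:\<Omega>|lebesgue. (u x t)\<^sup>2)) (at t)"
proof -
  show "(u x has_real_derivative a * uptake (u x t) (\<xi> t) - d * u x t) (at t)" if "x \<in> \<Omega>"
    using assms that unfolding nonneg_global_solution_def rate_eq_uptake by blast
  have "(\<xi> has_real_derivative - \<xi> t - \<xi> t * (LINT x:\<Omega>|lebesgue. (u x t)\<^sup>2) + \<kappa>) (at t)"
    using assms unfolding nonneg_global_solution_def by blast
  then show "(\<xi> has_real_derivative \<kappa> - \<xi> t - \<xi> t * (LINT x:\<Omega>|lebesgue. (u x t)\<^sup>2)) (at t)"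
    by (simp add: algebra_simps)
qed

lemma solution_nonneg:
  assumes "nonneg_global_solution \<Omega> a d \<kappa> u\<^sub>0 \<xi>\<^sub>0 u \<xi>" "0 \<le> t"
  shows "x \<in> closure \<Omega> \<Longrightarrow> 0 \<le> u x t" and "0 \<le> \<xi> t"
  using assms by (auto simp: nonneg_global_solution_def)

lemma solution_initial:
  assumes "nonneg_global_solution \<Omega> a d \<kappa> u\<^sub>0 \<xi>\<^sub>0 u \<xi>"
  shows "x \<in> closure \<Omega> \<Longrightarrow> u x 0 = u\<^sub>0 x" and "\<xi> 0 = \<xi>\<^sub>0"
  using assms by (auto simp: nonneg_global_solution_def)

text \<open>The uptake is at most \<open>u\<close>, so \<open>u\<close> grows at most at rate
  \<open>a - d\<close>.\<close>

lemma solution_le: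
  assumes sol: "nonneg_global_solution \<Omega> a d \<kappa> u\<^sub>0 \<xi>\<^sub>0 u \<xi>" and "x \<in> \<Omega>" "0 \<le> t"
  shows "u x t \<le> exp ((a - d) * t) * u\<^sub>0 x"
proof -
  have x: "x \<in> closure \<Omega>" using \<open>x \<in> \<Omega>\<close> closure_subset by blast
  have "u x t \<le> exp ((a - d) * t) * u x 0"
  proof (rule le_exp_of_deriv_le)
    show "a * uptake (u x s) (\<xi> s) - d * u x s \<le> (a - d) * u x s" if "0 < s" for s
      using uptake_le[of "u x s" "\<xi> s"] solution_nonneg[OF sol, of s] x that a_pos
      by (simp add: left_diff_distrib)
  qed (use solution_continuous(1)[OF sol x] solution_deriv(1)[OF sol _ \<open>x \<in> \<Omega>\<close>] \<open>0 \<le> t\<close> in auto)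
  then show ?thesis using solution_initial(1)[OF sol x] by simp
qed

text \<open>Dropping the nonnegative consumption term leaves
  \<open>\<xi>' \<le> \<kappa> - \<xi>\<close>.\<close>

lemma resource_le:
  assumes sol: "nonneg_global_solution \<Omega> a d \<kappa> u\<^sub>0 \<xi>\<^sub>0 u \<xi>" and "0 \<le> t"
  shows "\<xi> t \<le> max \<xi>\<^sub>0 \<kappa>"
proof -
  have "\<xi> t \<le> max (\<xi> 0) (\<kappa> / 1)"
  proof (rule le_max_of_deriv_le[where f = \<xi>])
    fix s :: real assume "0 < s"
    \<comment> \<open>This holds without integrability, the default value of the integral being
      \<open>0\<close>.\<close>
    have "0 \<le> (LINT x:\<Omega>|lebesgue. (u x s)\<^sup>2)"
      unfolding set_lebesgue_integral_def by (rule Bochner_Integration.integral_nonneg) auto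
    then show "\<kappa> - \<xi> s - \<xi> s * (LINT x:\<Omega>|lebesgue. (u x s)\<^sup>2) \<le> \<kappa> - 1 * \<xi> s"
      using solution_nonneg(2)[OF sol, of s] \<open>0 < s\<close> by simp
  qed (use solution_continuous(2)[OF sol] solution_deriv(2)[OF sol] \<open>0 \<le> t\<close> in auto)
  then show ?thesis using solution_initial(2)[OF sol] by simp
qed

text \<open>
  In the norm weighted by \<open>exp (- 2 L t)\<close>, with \<open>L\<close> a Lipschitz constant up to time \<open>T\<close>, the distance of
  two solutions is at most half of itself.
\<close>

lemma solutions_agree:
  assumes sol: "nonneg_global_solution \<Omega> a d \<kappa> u\<^sub>0 \<xi>\<^sub>0 u \<xi>"
    and sol': "nonneg_global_solution \<Omega> a d \<kappa> u\<^sub>0 \<xi>\<^sub>0 v \<eta>"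
    and M: "\<And>x. x \<in> \<Omega> \<Longrightarrow> u\<^sub>0 x \<le> M" and "0 \<le> M" and "0 \<le> T"
  shows "x \<in> \<Omega> \<Longrightarrow> u x T = v x T" and "\<xi> T = \<eta> T"
proof -
  \<comment> \<open>\<open>B\<close> and \<open>K\<close> bound both solutions up to time
    \<open>T\<close>; the exponent \<open>a * T\<close> dominates \<open>(a - d) * t\<close>
    whatever the sign of \<open>a - d\<close>.\<close>
  define B K where "B = M * exp (a * T)" and "K = max \<xi>\<^sub>0 \<kappa>"
  define L where "L = lip_const K B"
  have B: "0 \<le> B" using \<open>0 \<le> M\<close> by (simp add: B_def)
  have K: "0 \<le> K" using \<kappa>_pos by (simp add: K_def)
  have L: "0 < L" "a + d + a * B\<^sup>2 \<le> L" "1 + B\<^sup>2 + 2 * K * B \<le> L"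
    using a_pos d_pos B K by (auto simp: L_def lip_const_def algebra_simps add_pos_nonneg)
  have sub: "x \<in> closure \<Omega>" if "x \<in> \<Omega>" for x using that closure_subset by blast
  have le_B: "w x t \<le> B" if "nonneg_global_solution \<Omega> a d \<kappa> u\<^sub>0 \<xi>\<^sub>0 w \<zeta>" "x \<in> \<Omega>" "0 \<le> t" "t \<le> T" for w \<zeta> x t
  proof -
    have "(a - d) * t \<le> a * T" using that a_pos d_pos
      by (intro mult_mono) auto
    then have "exp ((a - d) * t) * u\<^sub>0 x \<le> exp (a * T) * M"
      using M[OF that(2)] solution_nonneg(1)[OF sol order_refl sub[OF that(2)]]
        solution_initial(1)[OF sol sub[OF that(2)]] by (intro mult_mono) auto
    then show ?thesis using solution_le[OF that(1-3)] by (simp add: B_def mult.commute)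
  qed
  define S where "S = (\<lambda>(x, t). exp (- (2 * L * t)) * \<bar>u x t - v x t\<bar>) ` (\<Omega> \<times> {0..T}) \<union>
    (\<lambda>t. exp (- (2 * L * t)) * \<bar>\<xi> t - \<eta> t\<bar>) ` {0..T}"
  define m where "m = Sup S"
  \<comment> \<open>Without an upper bound \<open>Sup S\<close> would carry no information; the a
    priori bounds provide one.\<close>
  have bdd: "bdd_above S"
  proof (rule bdd_aboveI)
    have aux: "exp (- (2 * L * t)) * \<bar>p - q\<bar> \<le> B + K"
      if "0 \<le> p" "0 \<le> q" "p \<le> B \<and> q \<le> B \<or> p \<le> K \<and> q \<le> K" "0 \<le> t" for p q t
    proof -
      have "exp (- (2 * L * t)) * \<bar>p - q\<bar> \<le> 1 * (B + K)"
        using that L B K by (intro mult_mono) auto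
      then show ?thesis by simp
    qed
    fix s assume "s \<in> S"
    then show "s \<le> B + K"
      unfolding S_def K_def
      using le_B[OF sol] le_B[OF sol'] resource_le[OF sol] resource_le[OF sol']
        solution_nonneg[OF sol] solution_nonneg[OF sol'] sub
      by (auto intro!: aux[unfolded K_def])
  qed
  have u_le: "\<bar>u x t - v x t\<bar> \<le> m * exp (2 * L * t)" if "x \<in> \<Omega>" "0 \<le> t" "t \<le> T" for x t
  proof -
    have "exp (- (2 * L * t)) * \<bar>u x t - v x t\<bar> \<le> m"
      unfolding m_def by (rule cSup_upper[OF _ bdd]) (use that in \<open>auto simp: S_def\<close>)
    then show ?thesis by (simp add: exp_minus field_simps)
  qed
  have \<xi>_le: "\<bar>\<xi> t - \<eta> t\<bar> \<le> m * exp (2 * L * t)" if "0 \<le> t" "t \<le> T" for t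
  proof -
    have "exp (- (2 * L * t)) * \<bar>\<xi> t - \<eta> t\<bar> \<le> m"
      unfolding m_def by (rule cSup_upper[OF _ bdd]) (use that in \<open>auto simp: S_def\<close>)
    then show ?thesis by (simp add: exp_minus field_simps)
  qed
  have m: "0 \<le> m" using \<xi>_le[of 0] \<open>0 \<le> T\<close> by simp
  \<comment> \<open>The derivatives differ by at most \<open>L * m * exp (2 * L * s)\<close>;
    integration from the common initial value divides by \<open>2 * L\<close>, leaving
    \<open>m / 2\<close> as the factor.\<close>
  have u_half: "\<bar>u x t - v x t\<bar> \<le> L * m / (2 * L) * exp (2 * L * t)" if "x \<in> \<Omega>" "0 \<le> t" "t \<le> T" for x t
  proof (rule abs_le_exp_of_deriv_le[where T = T and f = "\<lambda>t. u x t - v x t"])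
    show "continuous_on {0..T} (\<lambda>t. u x t - v x t)"
      using solution_continuous(1)[OF sol sub[OF that(1)]] solution_continuous(1)[OF sol' sub[OF that(1)]]
      by (auto intro!: continuous_intros elim: continuous_on_subset)
    show "u x 0 - v x 0 = 0"
      using solution_initial(1)[OF sol] solution_initial(1)[OF sol'] sub[OF that(1)] by simp
    fix s assume s: "0 < s" "s < T"
    show "((\<lambda>t. u x t - v x t) has_real_derivative
        (a * uptake (u x s) (\<xi> s) - d * u x s) - (a * uptake (v x s) (\<eta> s) - d * v x s)) (at s)"
      by (intro DERIV_diff solution_deriv(1)[OF sol s(1) that(1)] solution_deriv(1)[OF sol' s(1) that(1)])
    have "\<bar>(a * uptake (u x s) (\<xi> s) - d * u x s) - (a * uptake (v x s) (\<eta> s) - d * v x s)\<bar>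
      \<le> (a + d + a * B\<^sup>2) * (m * exp (2 * L * s))"
      using s that(1) sub le_B[OF sol'] solution_nonneg[OF sol] solution_nonneg[OF sol'] u_le \<xi>_le
      by (intro rate_difference_le) auto
    also have "\<dots> \<le> L * (m * exp (2 * L * s))" using L m by (intro mult_right_mono) auto
    finally show "\<bar>(a * uptake (u x s) (\<xi> s) - d * u x s) - (a * uptake (v x s) (\<eta> s) - d * v x s)\<bar>
      \<le> L * m * exp (2 * L * s)" by (simp add: mult.assoc)
  qed (use L m that in auto)
  have \<xi>_half: "\<bar>\<xi> t - \<eta> t\<bar> \<le> L * m / (2 * L) * exp (2 * L * t)" if "0 \<le> t" "t \<le> T" for t
  proof (rule abs_le_exp_of_deriv_le[where T = T and f = "\<lambda>t. \<xi> t - \<eta> t"])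
    show "continuous_on {0..T} (\<lambda>t. \<xi> t - \<eta> t)"
      using solution_continuous(2)[OF sol] solution_continuous(2)[OF sol']
      by (auto intro!: continuous_intros elim: continuous_on_subset)
    show "\<xi> 0 - \<eta> 0 = 0"
      using solution_initial(2)[OF sol] solution_initial(2)[OF sol'] by simp
    fix s assume s: "0 < s" "s < T"
    let ?D = "(\<kappa> - \<xi> s - \<xi> s * (LINT x:\<Omega>|lebesgue. (u x s)\<^sup>2)) -
      (\<kappa> - \<eta> s - \<eta> s * (LINT x:\<Omega>|lebesgue. (v x s)\<^sup>2))"
    show "((\<lambda>t. \<xi> t - \<eta> t) has_real_derivative ?D) (at s)"
      by (intro DERIV_diff solution_deriv(2)[OF sol s(1)] solution_deriv(2)[OF sol' s(1)])
    have "\<bar>?D\<bar> \<le> (1 + B\<^sup>2 + 2 * K * B) * (m * exp (2 * L * s))"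
    proof (rule resource_difference_le)
      show "continuous_on \<Omega> (\<lambda>x. u x s)" "continuous_on \<Omega> (\<lambda>x. v x s)"
        using solution_continuous(3)[OF sol, of s] solution_continuous(3)[OF sol', of s] s
        by (auto intro: continuous_on_subset[OF _ closure_subset])
    qed (use s sub le_B[OF sol] le_B[OF sol'] solution_nonneg[OF sol] solution_nonneg[OF sol'] u_le \<xi>_le
         B resource_le[OF sol'] in \<open>auto simp: K_def\<close>)
    also have "\<dots> \<le> L * (m * exp (2 * L * s))" using L m by (intro mult_right_mono) auto
    finally show "\<bar>?D\<bar> \<le> L * m * exp (2 * L * s)" by (simp add: mult.assoc)
  qed (use L m that in auto)
  have "m \<le> m / 2"
    unfolding m_def
  proof (rule cSup_least, fold m_def)
    show "S \<noteq> {}" using \<open>0 \<le> T\<close> by (auto simp: S_def)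
    have aux: "exp (- (2 * L * t)) * p \<le> m / 2" if "p \<le> L * m / (2 * L) * exp (2 * L * t)" for p t
      using that L(1) by (simp add: exp_minus field_simps)
    show "s \<le> m / 2" if "s \<in> S" for s
      using that aux[OF u_half] aux[OF \<xi>_half] unfolding S_def by auto
  qed
  with m have "m = 0" by simp
  then show "\<xi> T = \<eta> T" and "x \<in> \<Omega> \<Longrightarrow> u x T = v x T"
    using u_le[of x T] \<xi>_le[of T] \<open>0 \<le> T\<close> by auto
qed

text \<open>The derivative of \<open>w\<close> is kept in the supremum norm: this later yields
  continuity in time uniformly in space and differentiability of the total mass.\<close>

lemma bcontfun_solution_exists:
  fixes g :: "(real ^ 'n) \<Rightarrow>\<^sub>C real"
  assumes g: "\<And>x. 0 \<le> g x" and "0 < \<xi>\<^sub>0"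
  obtains w :: "real \<Rightarrow> (real ^ 'n) \<Rightarrow>\<^sub>C real" and \<xi> :: "real \<Rightarrow> real" and w' \<xi>'
  where "w 0 = g" "\<xi> 0 = \<xi>\<^sub>0"
    and "\<And>t. 0 \<le> t \<Longrightarrow> (w has_vector_derivative w' t) (at t within {0..})"
    and "\<And>t. 0 \<le> t \<Longrightarrow> (\<xi> has_real_derivative \<xi>' t) (at t within {0..})"
    and "continuous_on {0..} w'" "continuous_on {0..} \<xi>'"
    and "\<And>x t. 0 \<le> t \<Longrightarrow> w' t x = a * uptake (w t x) (\<xi> t) - d * w t x"
    and "\<And>t. 0 \<le> t \<Longrightarrow> \<xi>' t = \<kappa> - \<xi> t - \<xi> t * (LINT x:\<Omega>|lebesgue. (w t x)\<^sup>2)"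
    and "\<And>x t. 0 \<le> t \<Longrightarrow> 0 \<le> w t x" "\<And>t. 0 \<le> t \<Longrightarrow> 0 < \<xi> t"
proof -
  define M K where "M = norm g" and "K = max \<xi>\<^sub>0 \<kappa>"
  have K: "0 \<le> K" using \<kappa>_pos by (simp add: K_def)
  let ?R = "\<lambda>t. M * exp (a * t)"
  have R: "0 \<le> ?R t" for t by (simp add: M_def)
  obtain z where z: "z 0 = (g, \<xi>\<^sub>0)"
      "\<And>t. 0 \<le> t \<Longrightarrow> (z has_vector_derivative trunc_field K (?R t) (z t)) (at t within {0..})"
      "continuous_on {0..} (\<lambda>t. trunc_field K (?R t) (z t))"
    by (rule trunc_flow_exists[OF K, of M "(g, \<xi>\<^sub>0)"]) (auto simp: M_def)
  define w \<xi> where "w = (\<lambda>t. fst (z t))" and "\<xi> = (\<lambda>t. snd (z t))"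
  define w' \<xi>' where "w' = (\<lambda>t. fst (trunc_field K (?R t) (z t)))"
    and "\<xi>' = (\<lambda>t. snd (trunc_field K (?R t) (z t)))"
  have der_w: "(w has_vector_derivative w' t) (at t within {0..})" if "0 \<le> t" for t
    unfolding w_def w'_def by (rule bounded_linear.has_vector_derivative[OF bounded_linear_fst z(2)[OF that]])
  have der_\<xi>: "(\<xi> has_real_derivative \<xi>' t) (at t within {0..})" if "0 \<le> t" for t
    unfolding \<xi>_def \<xi>'_def has_real_derivative_iff_has_vector_derivative
    by (rule bounded_linear.has_vector_derivative[OF bounded_linear_snd z(2)[OF that]])
  have der_wx: "((\<lambda>t. w t x) has_real_derivative w' t x) (at t within {0..})" if "0 \<le> t" for t x
    unfolding has_real_derivative_iff_has_vector_derivative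
    by (rule bounded_linear.has_vector_derivative[OF bounded_linear_apply_bcontfun der_w[OF that]])
  have cont_wx: "continuous_on {0..} (\<lambda>t. w t x)" for x
    using der_wx by (auto simp: continuous_on_eq_continuous_within intro: DERIV_continuous)
  have cont_\<xi>: "continuous_on {0..} \<xi>"
    using der_\<xi> by (auto simp: continuous_on_eq_continuous_within intro: DERIV_continuous)
  have w': "w' t x = a * uptake (trunc (?R t) (w t x)) (trunc K (\<xi> t)) - d * w t x" for t x
    by (simp add: w'_def apply_trunc_field[OF R] trunc_rate_def w_def \<xi>_def)
  have \<xi>': "\<xi>' t = \<kappa> - \<xi> t - trunc K (\<xi> t) * trunc_mass (?R t) (w t)" for t
    by (simp add: \<xi>'_def trunc_field_def w_def \<xi>_def)
  have w_nonneg: "0 \<le> w t x" if "0 \<le> t" for t x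
  proof -
    \<comment> \<open>The uptake is nonnegative, so \<open>- w\<close> obeys a linear inequality
      with rate \<open>- d\<close>.\<close>
    have "- w t x \<le> exp (- d * t) * (- w 0 x)"
    proof (rule le_exp_of_deriv_le[where f = "\<lambda>t. - w t x"])
      show "((\<lambda>t. - w t x) has_real_derivative - w' s x) (at s)" if "0 < s" for s
        using der_wx[of s x] that by (auto intro!: derivative_eq_intros simp: at_within_halfline)
      show "- w' s x \<le> - d * - w s x" if "0 < s" for s
        using uptake_nonneg[OF trunc_nonneg trunc_nonneg] a_pos by (simp add: w')
    qed (use that cont_wx in \<open>auto intro!: continuous_intros\<close>)
    moreover have "0 \<le> exp (- d * t) * w 0 x" using g by (simp add: w_def z(1))
    ultimately show ?thesis by simp
  qed
  have w_le: "w t x \<le> ?R t" if "0 \<le> t" for t x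
  proof -
    \<comment> \<open>The crude rate \<open>a\<close> matches the cut-off level
      \<open>M * exp (a * t)\<close>.\<close>
    have "w t x \<le> exp (a * t) * w 0 x"
    proof (rule le_exp_of_deriv_le[where f = "\<lambda>t. w t x"])
      show "((\<lambda>t. w t x) has_real_derivative w' s x) (at s)" if "0 < s" for s
        using der_wx[of s x] that by (simp add: at_within_halfline)
      show "w' s x \<le> a * w s x" if "0 < s" for s
      proof -
        have "uptake (trunc (?R s) (w s x)) (trunc K (\<xi> s)) \<le> w s x"
          using uptake_le[OF trunc_nonneg trunc_nonneg] trunc_le_self w_nonneg[of s x] that
          by (meson less_imp_le order_trans)
        then have "a * uptake (trunc (?R s) (w s x)) (trunc K (\<xi> s)) \<le> a * w s x" using a_pos by simp
        moreover have "0 \<le> d * w s x" using d_pos w_nonneg[of s x] that by simp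
        ultimately show ?thesis by (simp add: w')
      qed
    qed (use that cont_wx in auto)
    also have "\<dots> \<le> exp (a * t) * M"
      using norm_bounded[of g x] by (simp add: w_def z(1) M_def)
    finally show ?thesis by (simp add: mult.commute)
  qed
  \<comment> \<open>Below the cut-off level truncation acts as the identity.\<close>
  have mass: "trunc_mass (?R t) (w t) = (LINT x:\<Omega>|lebesgue. (w t x)\<^sup>2)" if "0 \<le> t" for t
    using w_nonneg[OF that] w_le[OF that] by (simp add: trunc_mass_def trunc_eq)
  have mass_nonneg: "0 \<le> trunc_mass r v" for r v
    unfolding trunc_mass_def set_lebesgue_integral_def
    by (rule Bochner_Integration.integral_nonneg) auto
  have \<xi>_pos: "0 < \<xi> t" if "0 \<le> t" for t
  proof (rule pos_of_deriv_pos_at_zeros[where f = \<xi>])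
    \<comment> \<open>At a zero of \<open>\<xi>\<close> both loss terms vanish, leaving the
      derivative \<open>\<kappa>\<close>.\<close>
    show "\<exists>D>0. (\<xi> has_real_derivative D) (at s)" if "0 < s" "\<xi> s = 0" for s
      using der_\<xi>[of s] that \<kappa>_pos trunc_eq[OF order_refl K]
      by (intro exI[of _ "\<xi>' s"]) (auto simp: \<xi>' at_within_halfline)
  qed (use that cont_\<xi> \<open>0 < \<xi>\<^sub>0\<close> in \<open>auto simp: \<xi>_def z(1)\<close>)
  have \<xi>_le: "\<xi> t \<le> K" if "0 \<le> t" for t
  proof -
    have "\<xi> t \<le> max (\<xi> 0) (\<kappa> / 1)"
    proof (rule le_max_of_deriv_le[where f = \<xi>])
      show "\<xi>' s \<le> \<kappa> - 1 * \<xi> s" for s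
        using trunc_nonneg mass_nonneg by (simp add: \<xi>')
    qed (use that cont_\<xi> der_\<xi> in \<open>auto simp: at_within_halfline[symmetric]\<close>)
    then show ?thesis by (simp add: K_def \<xi>_def z(1))
  qed
  show ?thesis
  proof
    show "w 0 = g" "\<xi> 0 = \<xi>\<^sub>0" by (auto simp: w_def \<xi>_def z(1))
    show "continuous_on {0..} w'" "continuous_on {0..} \<xi>'"
      unfolding w'_def \<xi>'_def by (intro continuous_intros z(3))+
    show "w' t x = a * uptake (w t x) (\<xi> t) - d * w t x" if "0 \<le> t" for t x
      using w_nonneg[OF that] w_le[OF that] \<xi>_pos[OF that] \<xi>_le[OF that] by (simp add: w' trunc_eq)
    show "\<xi>' t = \<kappa> - \<xi> t - \<xi> t * (LINT x:\<Omega>|lebesgue. (w t x)\<^sup>2)" if "0 \<le> t" for t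
      using \<xi>_pos[OF that] \<xi>_le[OF that] by (simp add: \<xi>' mass[OF that] trunc_eq)
    show "(w has_vector_derivative w' t) (at t within {0..})"
      "(\<xi> has_real_derivative \<xi>' t) (at t within {0..})" "0 < \<xi> t" if "0 \<le> t" for t
      using that by (rule der_w, rule der_\<xi>, rule \<xi>_pos)
    show "0 \<le> w t x" if "0 \<le> t" for t x
      using that by (rule w_nonneg)
  qed
qed

end

text \<open>Tietze extension preserves the bound, and the positive part restores nonnegativity
  without changing the values on \<open>S\<close>.\<close>

lemma nonneg_bcontfun_extension:
  fixes f :: "real ^ 'n \<Rightarrow> real"
  assumes "compact S" "continuous_on S f" "\<forall>x\<in>S. 0 \<le> f x"
  obtains g :: "(real ^ 'n) \<Rightarrow>\<^sub>C real" where "\<And>x. 0 \<le> g x" "\<And>x. x \<in> S \<Longrightarrow> g x = f x"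
proof -
  have "bounded (f ` S)" using assms by (intro compact_imp_bounded compact_continuous_image)
  then obtain B where B: "0 < B" "\<forall>x\<in>S. norm (f x) \<le> B" by (auto simp: bounded_pos)
  obtain h where h: "continuous_on UNIV h" "\<And>x. x \<in> S \<Longrightarrow> h x = f x" "\<And>x. norm (h x) \<le> B"
    using Tietze[of S f UNIV B] assms B by (auto simp: compact_imp_closed)
  have "(\<lambda>x. max 0 (h x)) \<in> bcontfun"
  proof (rule bcontfun_normI)
    show "continuous_on UNIV (\<lambda>x. max 0 (h x))" by (intro continuous_intros h(1))
    show "norm (max 0 (h x)) \<le> B" for x using h(3)[of x] B(1) by (auto simp: max_def)
  qed
  then have "apply_bcontfun (Bcontfun (\<lambda>x. max 0 (h x))) = (\<lambda>x. max 0 (h x))"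
    by (rule Bcontfun_inverse)
  then show ?thesis
    using assms(3) h(2) by (intro that[of "Bcontfun (\<lambda>x. max 0 (h x))"]) auto
qed

section \<open>Mass bound, existence and uniqueness for the original problem\<close>

context resource_model
begin

text \<open>
  The uptake is at most \<open>\<xi> u\<^sup>2\<close>, so the quadratic terms cancel in the derivative of \<open>\<integral> u + a \<xi>\<close>.
\<close>

lemma mass_bdd_above:
  fixes w w' :: "real \<Rightarrow> (real ^ 'n) \<Rightarrow>\<^sub>C real" and \<xi> \<xi>' :: "real \<Rightarrow> real"
  assumes der_w: "\<And>t. 0 \<le> t \<Longrightarrow> (w has_vector_derivative w' t) (at t within {0..})"
    and der_\<xi>: "\<And>t. 0 \<le> t \<Longrightarrow> (\<xi> has_real_derivative \<xi>' t) (at t within {0..})"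
    and w': "\<And>x t. 0 \<le> t \<Longrightarrow> w' t x = a * uptake (w t x) (\<xi> t) - d * w t x"
    and \<xi>': "\<And>t. 0 \<le> t \<Longrightarrow> \<xi>' t = \<kappa> - \<xi> t - \<xi> t * (LINT x:\<Omega>|lebesgue. (w t x)\<^sup>2)"
    and w: "\<And>x t. 0 \<le> t \<Longrightarrow> 0 \<le> w t x" and \<xi>: "\<And>t. 0 \<le> t \<Longrightarrow> 0 < \<xi> t"
  shows "bdd_above ((\<lambda>t. LINT x:\<Omega>|lebesgue. w t x) ` {0<..})"
proof -
  define U where "U = (\<lambda>t. LINT x:\<Omega>|lebesgue. w t x)"
  define U' where "U' = (\<lambda>t. LINT x:\<Omega>|lebesgue. w' t x)"
  \<comment> \<open>In the sum of total mass and \<open>a * \<xi>\<close> the summands are damped at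
    rates \<open>d\<close> and \<open>1\<close>; the smaller rate serves both.\<close>
  define \<mu> where "\<mu> = min d 1"
  have \<mu>: "0 < \<mu>" "\<mu> \<le> d" "\<mu> \<le> 1" using d_pos by (auto simp: \<mu>_def)
  have U_nonneg: "0 \<le> U t" if "0 \<le> t" for t
    unfolding U_def using w[OF that] by (intro integral_ge_dom set_integrable_bcontfun) auto
  have der_U: "(U has_real_derivative U' t) (at t within {0..})" if "0 \<le> t" for t
    unfolding U_def U'_def has_real_derivative_iff_has_vector_derivative
    by (rule bounded_linear.has_vector_derivative[OF bounded_linear_integral_dom der_w[OF that]])
  have der: "((\<lambda>t. U t + a * \<xi> t) has_real_derivative U' t + a * \<xi>' t) (at t within {0..})"
    if "0 \<le> t" for t
    using der_U[OF that] der_\<xi>[OF that] by (auto intro!: derivative_eq_intros)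
  have U'_le: "U' t \<le> a * \<xi> t * (LINT x:\<Omega>|lebesgue. (w t x)\<^sup>2) - d * U t" if "0 \<le> t" for t
  proof -
    have sq: "set_integrable lebesgue \<Omega> (\<lambda>x. (w t x)\<^sup>2)"
    proof (rule set_integrable_dom)
      show "\<bar>(w t x)\<^sup>2\<bar> \<le> (norm (w t))\<^sup>2" for x
        using norm_bounded[of "w t" x] by (simp add: abs_le_square_iff[symmetric])
    qed (auto intro!: continuous_intros)
    have int: "set_integrable lebesgue \<Omega> (\<lambda>x. a * \<xi> t * (w t x)\<^sup>2)"
        "set_integrable lebesgue \<Omega> (\<lambda>x. d * w t x)"
      using sq set_integrable_bcontfun by (auto intro: set_integrable_mult_right)
    have "U' t \<le> (LINT x:\<Omega>|lebesgue. a * \<xi> t * (w t x)\<^sup>2 - d * w t x)"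
      unfolding U'_def
    proof (rule set_integral_mono[OF set_integrable_bcontfun set_integral_diff(1)[OF int]])
      fix x
      show "w' t x \<le> a * \<xi> t * (w t x)\<^sup>2 - d * w t x"
        using mult_left_mono[OF uptake_le_square[OF w[OF that] less_imp_le[OF \<xi>[OF that]]], of a x] a_pos
        by (simp add: w'[OF that] mult.assoc)
    qed
    also have "\<dots> = a * \<xi> t * (LINT x:\<Omega>|lebesgue. (w t x)\<^sup>2) - d * U t"
      by (simp add: set_integral_diff(2)[OF int] U_def)
    finally show ?thesis .
  qed
  have "U t \<le> max (U 0 + a * \<xi> 0) (a * \<kappa> / \<mu>)" if "0 < t" for t
  proof -
    have "U t + a * \<xi> t \<le> max (U 0 + a * \<xi> 0) (a * \<kappa> / \<mu>)"
    proof (rule le_max_of_deriv_le[where f = "\<lambda>t. U t + a * \<xi> t"])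
      show "continuous_on {0..} (\<lambda>t. U t + a * \<xi> t)"
        using der by (auto simp: continuous_on_eq_continuous_within intro: DERIV_continuous)
      show "((\<lambda>t. U t + a * \<xi> t) has_real_derivative U' s + a * \<xi>' s) (at s)" if "0 < s" for s
        using der[of s] that by (simp add: at_within_halfline)
      fix s :: real assume s: "0 < s"
      have "U' s + a * \<xi>' s \<le> a * \<kappa> - d * U s - a * \<xi> s"
        using U'_le[of s] s by (simp add: \<xi>' algebra_simps)
      moreover have "\<mu> * U s \<le> d * U s" "\<mu> * (a * \<xi> s) \<le> 1 * (a * \<xi> s)"
        using U_nonneg[of s] \<xi>[of s] s \<mu> a_pos by (auto intro!: mult_right_mono)
      ultimately show "U' s + a * \<xi>' s \<le> a * \<kappa> - \<mu> * (U s + a * \<xi> s)"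
        by (simp add: distrib_left)
    qed (use \<mu> that in auto)
    moreover have "0 \<le> a * \<xi> t" using a_pos \<xi>[of t] that by simp
    ultimately show ?thesis by linarith
  qed
  then show ?thesis by (auto simp: U_def intro!: bdd_aboveI2)
qed

lemma solution_exists:
  assumes "continuous_on (closure \<Omega>) u\<^sub>0" "\<forall>x\<in>closure \<Omega>. 0 \<le> u\<^sub>0 x" "0 < \<xi>\<^sub>0"
  obtains u \<xi> where "nonneg_global_solution \<Omega> a d \<kappa> u\<^sub>0 \<xi>\<^sub>0 u \<xi>"
    and "\<And>x. C1_halfline (u x)" and "\<And>t. 0 \<le> t \<Longrightarrow> 0 < \<xi> t"
    and "bdd_above ((\<lambda>t. LINT x:\<Omega>|lebesgue. u x t) ` {0<..})"
proof -
  have "compact (closure \<Omega>)" using bounded_dom by (simp add: compact_closure)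
  then obtain g :: "(real ^ 'n) \<Rightarrow>\<^sub>C real" where g: "\<And>x. 0 \<le> g x" "\<And>x. x \<in> closure \<Omega> \<Longrightarrow> g x = u\<^sub>0 x"
    using nonneg_bcontfun_extension assms by blast
  obtain w w' :: "real \<Rightarrow> (real ^ 'n) \<Rightarrow>\<^sub>C real" and \<xi> \<xi>' where
    init: "w 0 = g" "\<xi> 0 = \<xi>\<^sub>0"
    and der_w: "\<And>t. 0 \<le> t \<Longrightarrow> (w has_vector_derivative w' t) (at t within {0..})"
    and der_\<xi>: "\<And>t. 0 \<le> t \<Longrightarrow> (\<xi> has_real_derivative \<xi>' t) (at t within {0..})"
    and cont': "continuous_on {0..} w'" "continuous_on {0..} \<xi>'"
    and w': "\<And>x t. 0 \<le> t \<Longrightarrow> w' t x = a * uptake (w t x) (\<xi> t) - d * w t x"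
    and \<xi>': "\<And>t. 0 \<le> t \<Longrightarrow> \<xi>' t = \<kappa> - \<xi> t - \<xi> t * (LINT x:\<Omega>|lebesgue. (w t x)\<^sup>2)"
    and w: "\<And>x t. 0 \<le> t \<Longrightarrow> 0 \<le> w t x" and \<xi>: "\<And>t. 0 \<le> t \<Longrightarrow> 0 < \<xi> t"
    using that by (rule bcontfun_solution_exists[OF g(1) assms(3)])
  have der_wx: "((\<lambda>t. w t x) has_real_derivative w' t x) (at t within {0..})" if "0 \<le> t" for t x
    unfolding has_real_derivative_iff_has_vector_derivative
    by (rule bounded_linear.has_vector_derivative[OF bounded_linear_apply_bcontfun der_w[OF that]])
  have C1_u: "C1_halfline (\<lambda>t. w t x)" for x
    unfolding C1_halfline_def
    using der_wx bounded_linear.continuous_on[OF bounded_linear_apply_bcontfun cont'(1)] by blast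
  have C1_\<xi>: "C1_halfline \<xi>" unfolding C1_halfline_def using der_\<xi> cont'(2) by blast
  have "C_time_space \<Omega> (\<lambda>x t. w t x)"
    unfolding C_time_space_def
  proof (intro conjI allI impI)
    fix t :: real assume t: "0 \<le> t"
    show "continuous_on (closure \<Omega>) (\<lambda>x. w t x)" by simp
    have "(w \<longlongrightarrow> w t) (at t within {0..})"
      using has_vector_derivative_continuous[OF der_w[OF t]] by (simp add: continuous_within)
    \<comment> \<open>Norm convergence of bounded continuous functions is uniform on the whole
      space, hence on \<open>closure \<Omega>\<close>.\<close>
    then have "uniform_limit UNIV (\<lambda>s x. w s x) (w t) (at t within {0..})"
      by (rule tendsto_bcontfun_uniform_limit)
    then show "uniform_limit (closure \<Omega>) (\<lambda>s x. w s x) (\<lambda>x. w t x) (at t within {0..})"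
      by (rule uniform_limit_on_subset) auto
  qed
  moreover have "((\<lambda>t. w t x) has_real_derivative
      (a * w t x * \<xi> t / (1 + w t x * \<xi> t) - d) * w t x) (at t)" if "0 < t" for x t
    using der_wx[of t x] that by (simp add: rate_eq_uptake w' at_within_halfline)
  moreover have "(\<xi> has_real_derivative - \<xi> t - \<xi> t * (LINT x:\<Omega>|lebesgue. (w t x)\<^sup>2) + \<kappa>) (at t)"
    if "0 < t" for t
    using der_\<xi>[of t] that by (simp add: \<xi>' at_within_halfline algebra_simps)
  ultimately have "nonneg_global_solution \<Omega> a d \<kappa> u\<^sub>0 \<xi>\<^sub>0 (\<lambda>x t. w t x) \<xi>"
    unfolding nonneg_global_solution_def using C1_\<xi> w less_imp_le[OF \<xi>] init g(2) by simp
  then show ?thesis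
    using C1_u \<xi> mass_bdd_above[OF der_w der_\<xi> w' \<xi>' w \<xi>] by (rule that)
qed

text \<open>The equation is imposed only on \<open>\<Omega>\<close>, so agreement is obtained there
  first and extended to the closure by continuity. Compactness of the closure bounds the initial
  datum.\<close>

lemma solution_unique:
  assumes sol: "nonneg_global_solution \<Omega> a d \<kappa> u\<^sub>0 \<xi>\<^sub>0 u \<xi>"
    and sol': "nonneg_global_solution \<Omega> a d \<kappa> u\<^sub>0 \<xi>\<^sub>0 v \<eta>"
    and cont: "continuous_on (closure \<Omega>) u\<^sub>0" and "0 \<le> t"
  shows "x \<in> closure \<Omega> \<Longrightarrow> v x t = u x t" and "\<eta> t = \<xi> t"
proof -
  have "bounded (u\<^sub>0 ` closure \<Omega>)"
    using bounded_dom cont by (intro compact_imp_bounded compact_continuous_image) (auto simp: compact_closure)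
  then obtain M where M: "0 < M" "\<And>x. x \<in> closure \<Omega> \<Longrightarrow> \<bar>u\<^sub>0 x\<bar> \<le> M" by (auto simp: bounded_pos)
  have le: "u\<^sub>0 x \<le> M" if "x \<in> \<Omega>" for x
    using M(2)[of x] closure_subset that abs_le_D1 by blast
  show "\<eta> t = \<xi> t" using solutions_agree(2)[OF sol sol' le _ \<open>0 \<le> t\<close>] M(1) by simp
  assume x: "x \<in> closure \<Omega>"
  have "u x t - v x t = 0"
  proof (rule continuous_constant_on_closure[OF _ _ x])
    show "continuous_on (closure \<Omega>) (\<lambda>x. u x t - v x t)"
      using solution_continuous(3)[OF sol \<open>0 \<le> t\<close>] solution_continuous(3)[OF sol' \<open>0 \<le> t\<close>]
      by (intro continuous_intros)
    show "u y t - v y t = 0" if "y \<in> \<Omega>" for y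
      using solutions_agree(1)[OF sol sol' le _ \<open>0 \<le> t\<close> that] M(1) by simp
  qed
  then show "v x t = u x t" by simp
qed

end

theorem proposition2p1:
  fixes \<Omega> :: "(real ^ 'n) set" and a d \<kappa>\<^sub>0 \<xi>\<^sub>0 :: real and u\<^sub>0 :: "real ^ 'n \<Rightarrow> real"
  assumes "bounded \<Omega>" and "\<Omega> \<in> sets lebesgue" and "measure lebesgue \<Omega> = 1"
    and "a > 0" and "d > 0" and "\<kappa>\<^sub>0 > 0"
    and "continuous_on (closure \<Omega>) u\<^sub>0" and "\<forall>x\<in>closure \<Omega>. 0 \<le> u\<^sub>0 x"
    and "\<xi>\<^sub>0 > 0"
  shows "\<exists>u \<xi>.
    nonneg_global_solution \<Omega> a d \<kappa>\<^sub>0 u\<^sub>0 \<xi>\<^sub>0 u \<xi> \<and>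
    (\<forall>v \<eta>. nonneg_global_solution \<Omega> a d \<kappa>\<^sub>0 u\<^sub>0 \<xi>\<^sub>0 v \<eta> \<longrightarrow>
       (\<forall>t\<ge>0. (\<forall>x\<in>closure \<Omega>. v x t = u x t) \<and> \<eta> t = \<xi> t)) \<and>
    (\<forall>x\<in>\<Omega>. C1_halfline (u x)) \<and>
    (\<forall>x\<in>\<Omega>. \<forall>t\<ge>0. 0 \<le> u x t \<and> u x t \<le> exp ((a - d) * t) * u\<^sub>0 x) \<and>
    (\<forall>t\<ge>0. 0 < \<xi> t \<and> \<xi> t \<le> max \<xi>\<^sub>0 \<kappa>\<^sub>0) \<and>
    bdd_above ((\<lambda>t. LINT x:\<Omega>|lebesgue. u x t) ` {0<..})"
proof -
  interpret resource_model \<Omega> a d \<kappa>\<^sub>0 using assms(1-6) by unfold_locales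
  \<comment> \<open>Regularity up to \<open>0\<close>, positivity of \<open>\<xi>\<close> and the
    mass bound come from the construction; the upper bounds on \<open>u\<close> and
    \<open>\<xi>\<close> hold for every solution.\<close>
  obtain u \<xi> where sol: "nonneg_global_solution \<Omega> a d \<kappa>\<^sub>0 u\<^sub>0 \<xi>\<^sub>0 u \<xi>"
    and C1: "\<And>x. C1_halfline (u x)" and pos: "\<And>t. 0 \<le> t \<Longrightarrow> 0 < \<xi> t"
    and bdd: "bdd_above ((\<lambda>t. LINT x:\<Omega>|lebesgue. u x t) ` {0<..})"
    using that by (rule solution_exists[OF assms(7-9)])
  show ?thesis
  proof (intro exI[of _ u] exI[of _ \<xi>] conjI allI ballI impI)
    show "0 \<le> u x t" if "x \<in> \<Omega>" "0 \<le> t" for x t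
      by (rule solution_nonneg(1)[OF sol that(2) subsetD[OF closure_subset that(1)]])
  qed (rule sol C1 pos bdd solution_unique[OF sol _ assms(7)] solution_le[OF sol] resource_le[OF sol];
       assumption)+
qed

end
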